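(* Suppose $\Phi(x,\xi)$ is a phase function (as defined in the context) that is real analytic in $x$ and $\xi$ away from $\xi=0$. Then there exist positive constants $\epsilon_0$ and $N_0$ such that the following is true. Let $A$ and $B$ be two squares in the spatial domain $[0,1]^2$ and in the frequency domain $[-N/2,N/2]^2$, respectively, obeying $w_A w_B\le 1$ and $\mathrm{dist}(B,0)\ge \frac{N}{4}$. For any positive $\epsilon\le\epsilon_0$ and any $N\ge N_0$, there exist an integer $r_\epsilon$ with $r_\epsilon\lesssim \log^4(1/\epsilon)$ and functions $\{\tilde\alpha^{AB}_t(x)\}_{1\le t\le r_\epsilon}$, $\{\tilde\beta^{AB}_t(\xi)\}_{1\le t\le r_\epsilon}$ such that $$\left| e^{2\pi \imath R^{AB}(x,\xi)}-\sum_{t=1}^{r_\epsilon}\tilde\alpha^{AB}_t(x)\,\tilde\beta^{AB}_t(\xi)\right|\le \epsilon \qquad\text{for all } x\in A,\ \xi\in B.$$ Moreover, (i) when $w_B\le\sqrt N$, the functions $\{\tilde\beta^{AB}_t(\xi)\}_{1\le t\le r_\epsilon}$ can all be chosen as monomials in $(\xi-c_B)$ with a degree not exceeding a constant times $\log^2(1/\epsilon)$; and (ii) when $w_A\le 1/\sqrt N$, the functions $\{\tilde\alpha^{AB}_t(x)\}_{1\le t\le r_\epsilon}$ can all be chosen as monomials in $(x-c_A)$ with a degree not exceeding a constant times $\log^2(1/\epsilon)$.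
   Context: The setting is two-dimensional. $N$ is a positive integer; the spatial grid $X=\{(n_1/N,n_2/N): 0\le n_1,n_2<N,\ n_1,n_2\in\mathbb{Z}\}$ lies in the unit square $[0,1]^2$, and the frequency grid $\Omega=\{(n_1,n_2): -N/2\le n_1,n_2<N/2,\ n_1,n_2\in\mathbb{Z}\}$ lies in $[-N/2,N/2]^2$. A phase function is a real-valued function $\Phi(x,\xi)$ of $x$ in the (closed) spatial domain $[0,1]^2$ and $\xi\in\mathbb{R}^2$, independent of $N$, that is smooth in $(x,\xi)$ for $\xi\ne 0$ and homogeneous of degree $1$ in $\xi$: $\Phi(x,\lambda\xi)=\lambda\Phi(x,\xi)$ for every $\lambda>0$. Real analyticity away from $\xi=0$ means real analyticity in $(x,\xi)$ for all $x$ in the closed spatial domain (i.e. in a neighbourhood of each of its points) and all $\xi\neq 0$. Squares are axis-parallel. For squares $A$ and $B$, $w_A,w_B$ denote their side lengths and $c_A,c_B$ their centers; $\mathrm{dist}(B,0)=\min_{\xi\in B}\|\xi\|$ with $\|\cdot\|$ the Euclidean norm. The residue phase function is $$R^{AB}(x,\xi):=\Phi(x,\xi)-\Phi(c_A,\xi)-\Phi(x,c_B)+\Phi(c_A,c_B).$$ A monomial in $(\xi-c_B)$ is a function $\xi\mapsto(\xi-c_B)^i=(\xi_1-c_{B,1})^{i_1}(\xi_2-c_{B,2})^{i_2}$ with $i=(i_1,i_2)$ a multi-index of nonnegative integers, of degree $i_1+i_2$; similarly for $(x-c_A)$. The constants $\epsilon_0,N_0$, the implicit constant in $\lesssim$,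 and the constants in the degree bounds depend only on $\Phi$; in particular they are independent of $N$, $\epsilon$, $A$ and $B$. *)

theory Defs
  imports "HOL-Analysis.Analysis"
begin

(* The two notions below are meant for an open set U; the index functions of the power series
   range over the multi-indices on Basis, and "has_sum" is unconditional convergence. *)

definition real_analytic_on_open :: "'a::euclidean_space set \<Rightarrow> ('a \<Rightarrow> real) \<Rightarrow> bool" where
  "real_analytic_on_open U f \<longleftrightarrow>
     (\<forall>p\<in>U. \<exists>a \<rho>. \<rho> > 0 \<and>
        (\<forall>y\<in>ball p \<rho>.
           ((\<lambda>i. a i * (\<Prod>b\<in>Basis. ((y - p) \<bullet> b) ^ i b)) has_sum f y)
             (Basis \<rightarrow>\<^sub>E (UNIV :: nat set))))"

primrec Ck_on_open :: "nat \<Rightarrow> 'a::euclidean_space set \<Rightarrow> ('a \<Rightarrow> real) \<Rightarrow> bool" where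
  "Ck_on_open 0 U f \<longleftrightarrow> continuous_on U f"
| "Ck_on_open (Suc k) U f \<longleftrightarrow>
     (\<exists>f'. (\<forall>y\<in>U. (f has_derivative f' y) (at y)) \<and> (\<forall>v. Ck_on_open k U (\<lambda>y. f' y v)))"

definition smooth_on_open :: "'a::euclidean_space set \<Rightarrow> ('a \<Rightarrow> real) \<Rightarrow> bool" where
  "smooth_on_open U f \<longleftrightarrow> (\<forall>k. Ck_on_open k U f)"

(* Regularity on a set S that need not be open: near each point of S, f restricted to S extends
   to a function with the property P on an open neighbourhood. Values of f outside S play no role. *)
definition extends_locally ::
    "('a::euclidean_space set \<Rightarrow> ('a \<Rightarrow> real) \<Rightarrow> bool) \<Rightarrow> 'a set \<Rightarrow> ('a \<Rightarrow> real) \<Rightarrow> bool" where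
  "extends_locally P S f \<longleftrightarrow>
     (\<forall>p\<in>S. \<exists>U g. open U \<and> p \<in> U \<and> P U g \<and> (\<forall>y\<in>U \<inter> S. g y = f y))"

abbreviation smooth_on :: "'a::euclidean_space set \<Rightarrow> ('a \<Rightarrow> real) \<Rightarrow> bool" where
  "smooth_on \<equiv> extends_locally smooth_on_open"

abbreviation real_analytic_on :: "'a::euclidean_space set \<Rightarrow> ('a \<Rightarrow> real) \<Rightarrow> bool" where
  "real_analytic_on \<equiv> extends_locally real_analytic_on_open"

abbreviation spatial_domain :: "(real ^ 2) set" where
  "spatial_domain \<equiv> cbox 0 1"

abbreviation frequency_domain :: "nat \<Rightarrow> (real ^ 2) set" where
  "frequency_domain N \<equiv> cbox (vec (- real N / 2)) (vec (real N / 2))"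

definition phase_function :: "(real ^ 2 \<Rightarrow> real ^ 2 \<Rightarrow> real) \<Rightarrow> bool" where
  "phase_function \<Phi> \<longleftrightarrow>
     smooth_on (spatial_domain \<times> (UNIV - {0})) (\<lambda>(x, \<xi>). \<Phi> x \<xi>) \<and>
     (\<forall>x\<in>spatial_domain. \<forall>\<xi>. \<forall>s>0. \<Phi> x (s *\<^sub>R \<xi>) = s * \<Phi> x \<xi>)"

(* Closed square with centre c and side length w. *)
definition square :: "real ^ 2 \<Rightarrow> real \<Rightarrow> (real ^ 2) set" where
  "square c w = cbox (c - vec (w / 2)) (c + vec (w / 2))"

definition residue_phase ::
    "(real ^ 2 \<Rightarrow> real ^ 2 \<Rightarrow> real) \<Rightarrow> real ^ 2 \<Rightarrow> real ^ 2 \<Rightarrow> real ^ 2 \<Rightarrow> real ^ 2 \<Rightarrow> real" where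
  "residue_phase \<Phi> c\<^sub>A c\<^sub>B x \<xi> = \<Phi> x \<xi> - \<Phi> c\<^sub>A \<xi> - \<Phi> x c\<^sub>B + \<Phi> c\<^sub>A c\<^sub>B"

definition separated_approx ::
    "(real ^ 2 \<Rightarrow> real ^ 2 \<Rightarrow> real) \<Rightarrow> real ^ 2 \<Rightarrow> real \<Rightarrow> real ^ 2 \<Rightarrow> real \<Rightarrow> real \<Rightarrow> nat \<Rightarrow>
       (nat \<Rightarrow> real ^ 2 \<Rightarrow> complex) \<Rightarrow> (nat \<Rightarrow> real ^ 2 \<Rightarrow> complex) \<Rightarrow> bool" where
  "separated_approx \<Phi> c\<^sub>A w\<^sub>A c\<^sub>B w\<^sub>B \<epsilon> r \<alpha> \<beta> \<longleftrightarrow>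
     (\<forall>x\<in>square c\<^sub>A w\<^sub>A. \<forall>\<xi>\<in>square c\<^sub>B w\<^sub>B.
        cmod (exp (2 * of_real pi * \<i> * of_real (residue_phase \<Phi> c\<^sub>A c\<^sub>B x \<xi>))
              - (\<Sum>t=1..r. \<alpha> t x * \<beta> t \<xi>)) \<le> \<epsilon>)"

(* Monomial in (z - c) of degree at most d. *)
definition is_monomial_about :: "real ^ 2 \<Rightarrow> real \<Rightarrow> (real ^ 2 \<Rightarrow> complex) \<Rightarrow> bool" where
  "is_monomial_about c d f \<longleftrightarrow>
     (\<exists>i :: nat ^ 2. real (\<Sum>j\<in>UNIV. i $ j) \<le> d \<and>
        f = (\<lambda>z. of_real (\<Prod>j\<in>UNIV. (z $ j - c $ j) ^ (i $ j))))"

end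

theory Submission
  imports Defs
begin

text \<open>By homogeneity \<open>\<Phi> x \<xi> = N * \<Phi> x (\<xi> / N)\<close>, the residue phase is \<open>N\<close> times a mixed second
  difference of \<open>\<Phi>\<close> on the compact set \<open>[0,1]\<^sup>2 \<times> {1/4 \<le> norm \<xi> \<le> 1}\<close>. Truncating the local power series
  of \<open>\<Phi>\<close> at total degree \<open>m\<close> leaves a tail whose mixed difference is at most
  \<open>C * norm (x - y) * norm (\<xi> - \<eta>) / 2 ^ m\<close>, uniformly by compactness, as long as both displacements are short.
  If only one of them is short, the other one is subdivided and the estimates are added up.
  As \<open>w\<^sub>A * w\<^sub>B \<le> 1\<close>, the residue phase is bounded and is within \<open>C / 2 ^ m\<close> of a polynomial of degree
  \<open>m\<close> in the variable whose displacement is short (\<open>\<xi>\<close> in case (i), \<open>x\<close> in case (ii)). Composing with the Taylor polynomial of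
  degree \<open>m\<close> of the exponential gives degree \<open>m\<^sup>2\<close>, and \<open>m\<close> proportional to \<open>ln (1 / \<epsilon>)\<close>
  suffices. One of the two cases always occurs, since \<open>w\<^sub>B > sqrt N\<close> forces \<open>w\<^sub>A < 1 / sqrt N\<close>.\<close>

subsection \<open>Polynomials in two variables\<close>

abbreviation mono2 :: "real ^ 2 \<Rightarrow> nat \<Rightarrow> nat \<Rightarrow> real ^ 2 \<Rightarrow> real" where
  "mono2 c i j z \<equiv> (z $ 1 - c $ 1) ^ i * (z $ 2 - c $ 2) ^ j"

text \<open>The degree bound is on each variable separately, so that exactly \<open>(d + 1)\<^sup>2\<close>
  monomials occur; quantifying over the centre makes the notion translation invariant.\<close>

definition poly2 :: "nat \<Rightarrow> (real ^ 2 \<Rightarrow> 'a::real_field) \<Rightarrow> bool" where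
  "poly2 d f \<longleftrightarrow> (\<forall>c. \<exists>a. \<forall>z. f z =
     (\<Sum>(i, j)\<in>{..d} \<times> {..d}. a i j * of_real (mono2 c i j z)))"

lemma poly2_monomial:
  assumes "i \<le> d" "j \<le> d"
  shows "\<exists>a. \<forall>z. k * of_real (mono2 c i j z) =
     (\<Sum>(i, j)\<in>{..d} \<times> {..d}. a i j * (of_real (mono2 c i j z) :: 'a::real_field))"
proof (rule exI, rule allI)
  fix z :: "real ^ 2"
  let ?m = "\<lambda>p. of_real (mono2 c (fst p) (snd p) z) :: 'a"
  have "(\<Sum>p\<in>{..d} \<times> {..d}. (if p = (i, j) then k else 0) * ?m p)
      = (\<Sum>p\<in>{..d} \<times> {..d}. if p = (i, j) then k * ?m p else 0)"
    by (rule sum.cong) simp_all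
  also have "\<dots> = k * ?m (i, j)"
    using assms by (subst sum.delta) simp_all
  finally show "k * of_real (mono2 c i j z) =
    (\<Sum>(i', j')\<in>{..d} \<times> {..d}. (if (i', j') = (i, j) then k else 0) * (of_real (mono2 c i' j' z) :: 'a))"
    by (simp only: case_prod_unfold prod.collapse fst_conv snd_conv)
qed

lemma poly2_add:
  assumes "poly2 d f" "poly2 d g"
  shows "poly2 d (\<lambda>z. f z + g z)"
  unfolding poly2_def
proof
  fix c
  obtain a where "\<forall>z. f z = (\<Sum>(i, j)\<in>{..d} \<times> {..d}. a i j * of_real (mono2 c i j z))"
    using assms(1) unfolding poly2_def by blast
  moreover obtain b where "\<forall>z. g z = (\<Sum>(i, j)\<in>{..d} \<times> {..d}. b i j * of_real (mono2 c i j z))"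
    using assms(2) unfolding poly2_def by blast
  ultimately have "\<forall>z. f z + g z = (\<Sum>(i, j)\<in>{..d} \<times> {..d}. (a i j + b i j) * of_real (mono2 c i j z))"
    by (simp add: sum.distrib case_prod_unfold distrib_right)
  then show "\<exists>a. \<forall>z. f z + g z = (\<Sum>(i, j)\<in>{..d} \<times> {..d}. a i j * of_real (mono2 c i j z))"
    by (intro exI[of _ "\<lambda>i j. a i j + b i j"])
qed

lemma poly2_const_le: "poly2 d (\<lambda>_. k)"
  unfolding poly2_def using poly2_monomial[of 0 d 0 k] by simp

lemma poly2_sum:
  assumes "\<And>s. s \<in> S \<Longrightarrow> poly2 d (f s)"
  shows "poly2 d (\<lambda>z. \<Sum>s\<in>S. f s z)"
  using assms
proof (induction S rule: infinite_finite_induct)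
  case (insert x S)
  then show ?case using poly2_add[of d "f x" "\<lambda>z. \<Sum>s\<in>S. f s z"] by simp
qed (simp_all add: poly2_const_le)

text \<open>Different indices in \<open>S\<close> may carry the same exponents. Expanding each term
  in the full basis of monomials and exchanging the two sums collects equal exponents; this gives
  the normal form after multiplying out a product or raising the degree bound.\<close>

lemma poly2_sum_monomials:
  fixes b :: "'s \<Rightarrow> 'a::real_field"
  assumes "\<And>s. s \<in> S \<Longrightarrow> i s \<le> d \<and> j s \<le> d"
  shows "\<exists>a. \<forall>z. (\<Sum>s\<in>S. b s * of_real (mono2 c (i s) (j s) z)) =
     (\<Sum>(i, j)\<in>{..d} \<times> {..d}. a i j * (of_real (mono2 c i j z)))"
proof -
  let ?P = "\<lambda>s a. \<forall>z. b s * of_real (mono2 c (i s) (j s) z) =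
     (\<Sum>(i, j)\<in>{..d} \<times> {..d}. a i j * of_real (mono2 c i j z))"
  have "\<forall>s\<in>S. \<exists>a. ?P s a"
  proof
    fix s assume "s \<in> S"
    then show "\<exists>a. ?P s a"
      using poly2_monomial[of "i s" d "j s" "b s" c] assms by simp
  qed
  from bchoice[OF this] obtain a where a: "\<forall>s\<in>S. ?P s (a s)" ..
  have "(\<Sum>s\<in>S. b s * of_real (mono2 c (i s) (j s) z)) =
      (\<Sum>(i, j)\<in>{..d} \<times> {..d}. (\<Sum>s\<in>S. a s i j) * of_real (mono2 c i j z))" for z
  proof -
    have "(\<Sum>s\<in>S. b s * of_real (mono2 c (i s) (j s) z)) =
       (\<Sum>s\<in>S. \<Sum>(i, j)\<in>{..d} \<times> {..d}. a s i j * of_real (mono2 c i j z))"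
      by (rule sum.cong[OF refl], rule a[rule_format])
    also have "\<dots> = (\<Sum>p\<in>{..d} \<times> {..d}. \<Sum>s\<in>S. a s (fst p) (snd p) * of_real (mono2 c (fst p) (snd p) z))"
      unfolding case_prod_unfold by (rule sum.swap)
    finally show ?thesis
      unfolding case_prod_unfold sum_distrib_right .
  qed
  then show ?thesis
    by (intro exI[of _ "\<lambda>i j. \<Sum>s\<in>S. a s i j"] allI)
qed

lemma poly2_mono:
  assumes "poly2 d f" "d \<le> e"
  shows "poly2 e f"
  unfolding poly2_def
proof
  fix c
  obtain a where a: "\<forall>z. f z = (\<Sum>(i, j)\<in>{..d} \<times> {..d}. a i j * of_real (mono2 c i j z))"
    using assms(1) unfolding poly2_def by blast
  show "\<exists>a. \<forall>z. f z = (\<Sum>(i, j)\<in>{..e} \<times> {..e}. a i j * of_real (mono2 c i j z))"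
    unfolding a[rule_format] unfolding case_prod_unfold
    by (rule poly2_sum_monomials[unfolded case_prod_unfold]) (use assms(2) in auto)
qed

lemma poly2_mult:
  assumes "poly2 d f" "poly2 e g"
  shows "poly2 (d + e) (\<lambda>z. f z * g z)"
  unfolding poly2_def
proof
  fix c
  obtain a where a: "\<forall>z. f z = (\<Sum>(i, j)\<in>{..d} \<times> {..d}. a i j * of_real (mono2 c i j z))"
    using assms(1) unfolding poly2_def by blast
  obtain b where b: "\<forall>z. g z = (\<Sum>(i, j)\<in>{..e} \<times> {..e}. b i j * of_real (mono2 c i j z))"
    using assms(2) unfolding poly2_def by blast
  let ?S = "({..d} \<times> {..d}) \<times> ({..e} \<times> {..e})"
  have fg: "\<forall>z. f z * g z = (\<Sum>s\<in>?S. (a (fst (fst s)) (snd (fst s)) * b (fst (snd s)) (snd (snd s))) *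
      of_real (mono2 c (fst (fst s) + fst (snd s)) (snd (fst s) + snd (snd s)) z))"
    unfolding a[rule_format] b[rule_format] sum_product sum.cartesian_product
    by (intro allI sum.cong) (auto simp: power_add algebra_simps)
  show "\<exists>a. \<forall>z. f z * g z = (\<Sum>(i, j)\<in>{..d+e} \<times> {..d+e}. a i j * of_real (mono2 c i j z))"
    unfolding fg[rule_format]
    by (rule poly2_sum_monomials[where S = ?S and i = "\<lambda>s. fst (fst s) + fst (snd s)" and j = "\<lambda>s. snd (fst s) + snd (snd s)"
        and b = "\<lambda>s. a (fst (fst s)) (snd (fst s)) * b (fst (snd s)) (snd (snd s))"])
       (auto intro: add_mono)
qed

lemma poly2_power:
  assumes "poly2 d f"
  shows "poly2 (k * d) (\<lambda>z. f z ^ k)"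
proof (induction k)
  case 0
  then show ?case by (simp add: poly2_const_le)
next
  case (Suc k)
  then show ?case using poly2_mult[OF assms Suc] by simp
qed

lemma poly2_prod:
  assumes "finite S" "\<And>s. s \<in> S \<Longrightarrow> poly2 (e s) (f s)"
  shows "poly2 (\<Sum>s\<in>S. e s) (\<lambda>z. \<Prod>s\<in>S. f s z)"
  using assms
proof (induction S)
  case empty
  then show ?case by (simp add: poly2_const_le)
next
  case (insert x S)
  then show ?case using poly2_mult[of "e x" "f x" "\<Sum>s\<in>S. e s" "\<lambda>z. \<Prod>s\<in>S. f s z"] by simp
qed

lemma poly2_cmult: "poly2 d f \<Longrightarrow> poly2 d (\<lambda>z. k * f z)"
  using poly2_mult[OF poly2_const_le[of 0 k]] by simp

lemma poly2_diff: "poly2 d f \<Longrightarrow> poly2 d g \<Longrightarrow> poly2 d (\<lambda>z. f z - g z)"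
  using poly2_add[of d f "\<lambda>z. (-1) * g z"] poly2_cmult[of d g "-1"] by simp

text \<open>The expansion is demanded about every centre \<open>c\<close>, so the coordinate is
  split as \<open>(z $ k - c $ k) + c $ k\<close>, a monomial plus a constant.\<close>

lemma poly2_coordinate: "poly2 1 (\<lambda>z. z $ k)"
proof -
  have 1: "\<exists>a. \<forall>z. z $ k - c $ k = (\<Sum>(i, j)\<in>{..1} \<times> {..1}. a i j * of_real (mono2 c i j z))"
    for c :: "real ^ 2"
  proof (cases "k = 1")
    case True
    then show ?thesis using poly2_monomial[of 1 1 0 "1::real" c] by simp
  next
    case False
    then have "k = 2" using exhaust_2[of k] by blast
    then show ?thesis using poly2_monomial[of 0 1 1 "1::real" c] by simp
  qed
  show ?thesis
    unfolding poly2_def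
  proof
    fix c :: "real ^ 2"
    from 1[of c] obtain a where a: "\<forall>z. z $ k - c $ k =
      (\<Sum>(i, j)\<in>{..1} \<times> {..1}. a i j * of_real (mono2 c i j z))" by blast
    obtain b where b: "\<forall>z. c $ k =
      (\<Sum>(i, j)\<in>{..1} \<times> {..1}. b i j * of_real (mono2 c i j z))"
      using poly2_const_le[of 1 "c $ k"] unfolding poly2_def by blast
    have "\<forall>z. z $ k = (\<Sum>(i, j)\<in>{..1} \<times> {..1}. (a i j + b i j) * of_real (mono2 c i j z))"
    proof
      fix z
      show "z $ k = (\<Sum>(i, j)\<in>{..1} \<times> {..1}. (a i j + b i j) * of_real (mono2 c i j z))"
        using a[rule_format, of z] b[rule_format, of z]
        by (simp add: case_prod_unfold distrib_right sum.distrib)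
    qed
    then show "\<exists>a. \<forall>z. z $ k = (\<Sum>(i, j)\<in>{..1} \<times> {..1}. a i j * of_real (mono2 c i j z))"
      by (intro exI[of _ "\<lambda>i j. a i j + b i j"])
  qed
qed

lemma poly2_inner: "poly2 1 (\<lambda>z. (z - p) \<bullet> b)"
proof -
  have "poly2 1 (\<lambda>z. (\<Sum>k\<in>UNIV. b $ k * z $ k) - b \<bullet> p)"
    by (rule poly2_diff, rule poly2_sum, rule poly2_cmult, rule poly2_coordinate, rule poly2_const_le)
  moreover have "(\<lambda>z. (\<Sum>k\<in>UNIV. b $ k * z $ k) - b \<bullet> p) = (\<lambda>z. (z - p) \<bullet> b)"
  proof
    fix z
    have "(z - p) \<bullet> b = b \<bullet> z - b \<bullet> p"
      by (metis inner_commute inner_diff_right)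
    moreover have "b \<bullet> z = (\<Sum>k\<in>UNIV. b $ k * z $ k)"
      by (simp only: inner_vec_def inner_real_def)
    ultimately show "(\<Sum>k\<in>UNIV. b $ k * z $ k) - b \<bullet> p = (z - p) \<bullet> b"
      by linarith
  qed
  ultimately show ?thesis
    by (rule back_subst[of "poly2 1"])
qed

text \<open>Freedom of the centre is what makes this direct: expanding \<open>f\<close> about
  \<open>s *\<^sub>R c\<close> turns each monomial in \<open>s *\<^sub>R z - s *\<^sub>R c\<close>
  into a multiple of the same monomial in \<open>z - c\<close>.\<close>

lemma poly2_scale:
  assumes "poly2 d f"
  shows "poly2 d (\<lambda>z. f (s *\<^sub>R z))"
  unfolding poly2_def
proof
  fix c
  obtain a where a: "\<forall>z. f z = (\<Sum>(i, j)\<in>{..d} \<times> {..d}. a i j * of_real (mono2 (s *\<^sub>R c) i j z))"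
    using assms unfolding poly2_def by blast
  have *: "mono2 (s *\<^sub>R c) i j (s *\<^sub>R z) = s ^ (i + j) * mono2 c i j z" for i j z
    by (simp add: power_add power_mult_distrib right_diff_distrib[symmetric])
  have "f (s *\<^sub>R z) = (\<Sum>(i, j)\<in>{..d} \<times> {..d}. (a i j * of_real (s ^ (i + j))) * of_real (mono2 c i j z))" for z
    unfolding a[rule_format] * of_real_mult mult.assoc ..
  then show "\<exists>a. \<forall>z. f (s *\<^sub>R z) = (\<Sum>(i, j)\<in>{..d} \<times> {..d}. a i j * of_real (mono2 c i j z))"
    by (intro exI[of _ "\<lambda>i j. a i j * of_real (s ^ (i + j))"] allI)
qed

lemma poly2_of_real:
  assumes "poly2 d (f :: real ^ 2 \<Rightarrow> real)"
  shows "poly2 d (\<lambda>z. of_real (f z))"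
  unfolding poly2_def
proof
  fix c
  obtain a where a: "\<forall>z. f z = (\<Sum>(i, j)\<in>{..d} \<times> {..d}. a i j * of_real (mono2 c i j z))"
    using assms(1) unfolding poly2_def by blast
  show "\<exists>a. \<forall>z. of_real (f z) = (\<Sum>(i, j)\<in>{..d} \<times> {..d}. a i j * of_real (mono2 c i j z))"
    by (intro exI[of _ "\<lambda>i j. of_real (a i j)"]) (simp add: a case_prod_unfold)
qed

lemma poly2_0_const:
  assumes "poly2 0 f"
  shows "f z = f y"
proof -
  obtain a where "\<forall>z. f z = (\<Sum>(i, j)\<in>{..0} \<times> {..0}. a i j * of_real (mono2 0 i j z))"
    using assms unfolding poly2_def by blast
  then have "f z = a 0 0" for z
    by simp
  then show ?thesis
    by metis
qed

subsection \<open>Mixed differences of analytic functions\<close>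

text \<open>The mixed second difference: the residue phase is the case y = c_A, \<eta> = c_B. It
  annihilates functions of one variable alone and telescopes in each pair of arguments.\<close>

definition mixdiff :: "('a \<Rightarrow> 'b \<Rightarrow> real) \<Rightarrow> 'a \<Rightarrow> 'a \<Rightarrow> 'b \<Rightarrow> 'b \<Rightarrow> real" where
  "mixdiff F x y \<xi> \<eta> = F x \<xi> - F y \<xi> - F x \<eta> + F y \<eta>"

text \<open>The error is measured relative to both displacements. Hence errors add up correctly
  along a subdivision, and the factor N produced by homogeneity can later be absorbed by the product
  of the displacements. Polynomiality is required in each variable because either one may become the
  expansion variable.\<close>

definition mixdiff_approx ::
    "(real ^ 2 \<Rightarrow> real ^ 2 \<Rightarrow> real) \<Rightarrow> (real ^ 2) set \<Rightarrow> (real ^ 2) set \<Rightarrow> real \<Rightarrow> nat \<Rightarrow>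
       (real ^ 2 \<Rightarrow> real ^ 2 \<Rightarrow> real) \<Rightarrow> bool" where
  "mixdiff_approx F A B e m P \<longleftrightarrow> (\<forall>x. poly2 m (P x)) \<and> (\<forall>\<xi>. poly2 m (\<lambda>x. P x \<xi>)) \<and>
     (\<forall>x\<in>A. \<forall>y\<in>A. \<forall>\<xi>\<in>B. \<forall>\<eta>\<in>B.
        \<bar>mixdiff (\<lambda>x \<xi>. F x \<xi> - P x \<xi>) x y \<xi> \<eta>\<bar> \<le> e * norm (x - y) * norm (\<xi> - \<eta>))"

lemma mixdiff_approxD:
  assumes "mixdiff_approx F A B e m P" "x \<in> A" "y \<in> A" "\<xi> \<in> B" "\<eta> \<in> B"
  shows "\<bar>mixdiff (\<lambda>x \<xi>. F x \<xi> - P x \<xi>) x y \<xi> \<eta>\<bar> \<le> e * norm (x - y) * norm (\<xi> - \<eta>)"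
  using assms unfolding mixdiff_approx_def by blast

lemma mixdiff_approx_poly:
  assumes "mixdiff_approx F A B e m P"
  shows "poly2 m (P x)" "poly2 m (\<lambda>x. P x \<xi>)"
  using assms unfolding mixdiff_approx_def by blast+

lemma mixdiff_approxI:
  assumes "\<And>x. poly2 m (P x)" "\<And>\<xi>. poly2 m (\<lambda>x. P x \<xi>)"
    and "\<And>x y \<xi> \<eta>. x \<in> A \<Longrightarrow> y \<in> A \<Longrightarrow> \<xi> \<in> B \<Longrightarrow> \<eta> \<in> B \<Longrightarrow>
      \<bar>mixdiff (\<lambda>x \<xi>. F x \<xi> - P x \<xi>) x y \<xi> \<eta>\<bar> \<le> e * norm (x - y) * norm (\<xi> - \<eta>)"
  shows "mixdiff_approx F A B e m P"
  unfolding mixdiff_approx_def by (intro conjI allI ballI assms)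

text \<open>Besides shrinking the sets, this replaces the function by one agreeing with it on them,
  which carries estimates from a local analytic extension back to the original function.\<close>

lemma mixdiff_approx_mono:
  assumes "mixdiff_approx F A B e m P" "A' \<subseteq> A" "B' \<subseteq> B" "e \<le> e'"
    and eq: "\<And>x \<xi>. x \<in> A' \<Longrightarrow> \<xi> \<in> B' \<Longrightarrow> G x \<xi> = F x \<xi>"
  shows "mixdiff_approx G A' B' e' m P"
proof (rule mixdiff_approxI)
  fix x y \<xi> \<eta>
  assume *: "x \<in> A'" "y \<in> A'" "\<xi> \<in> B'" "\<eta> \<in> B'"
  have "mixdiff (\<lambda>x \<xi>. G x \<xi> - P x \<xi>) x y \<xi> \<eta> = mixdiff (\<lambda>x \<xi>. F x \<xi> - P x \<xi>) x y \<xi> \<eta>"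
    by (simp only: mixdiff_def eq[OF *(1,3)] eq[OF *(1,4)] eq[OF *(2,3)] eq[OF *(2,4)])
  also have "\<bar>\<dots>\<bar> \<le> e * norm (x - y) * norm (\<xi> - \<eta>)"
    using assms(2,3) * by (intro mixdiff_approxD[OF assms(1)]) (simp_all only: subsetD)
  also have "\<dots> \<le> e' * norm (x - y) * norm (\<xi> - \<eta>)"
    using \<open>e \<le> e'\<close> by (intro mult_right_mono) auto
  finally show "\<bar>mixdiff (\<lambda>x \<xi>. G x \<xi> - P x \<xi>) x y \<xi> \<eta>\<bar> \<le> e' * norm (x - y) * norm (\<xi> - \<eta>)" .
qed (rule mixdiff_approx_poly[OF assms(1)])+

lemma mixdiff_approx_swap:
  assumes "mixdiff_approx F A B e m P"
  shows "mixdiff_approx (\<lambda>\<xi> x. F x \<xi>) B A e m (\<lambda>\<xi> x. P x \<xi>)"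
proof (rule mixdiff_approxI)
  fix \<xi> \<eta> x y
  assume *: "\<xi> \<in> B" "\<eta> \<in> B" "x \<in> A" "y \<in> A"
  have "mixdiff (\<lambda>\<xi> x. F x \<xi> - P x \<xi>) \<xi> \<eta> x y = mixdiff (\<lambda>x \<xi>. F x \<xi> - P x \<xi>) x y \<xi> \<eta>"
    by (simp add: mixdiff_def)
  then show "\<bar>mixdiff (\<lambda>\<xi> x. F x \<xi> - P x \<xi>) \<xi> \<eta> x y\<bar> \<le> e * norm (\<xi> - \<eta>) * norm (x - y)"
    using mixdiff_approxD[OF assms *(3,4,1,2)] by (simp only: mult_ac)
qed (rule mixdiff_approx_poly[OF assms])+

section \<open>Lipschitz bounds for monomials and truncation of the power series\<close>

text \<open>After division by \<open>t\<close> all factors have modulus at most 1, so the difference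
  of the products is at most the sum of the differences of the factors. The factor with exponent
  \<open>k b\<close> has Lipschitz constant \<open>k b / t\<close>, and the total degree n is
  bounded by \<open>2 ^ n\<close>. Thus the price of the Lipschitz estimate is only a doubling of
  the radius.\<close>

lemma prod_power_inner_lipschitz:
  fixes v w :: "'a::euclidean_space"
  assumes t: "t > 0"
    and v: "\<And>b. b \<in> Basis \<Longrightarrow> \<bar>v \<bullet> b\<bar> \<le> t" and w: "\<And>b. b \<in> Basis \<Longrightarrow> \<bar>w \<bullet> b\<bar> \<le> t"
  shows "\<bar>(\<Prod>b\<in>Basis. (v \<bullet> b) ^ k b) - (\<Prod>b\<in>Basis. (w \<bullet> b) ^ k b)\<bar>
           \<le> (2 * t) ^ (\<Sum>b\<in>Basis. k b) / t * norm (v - w)"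
proof -
  let ?n = "\<Sum>b\<in>Basis. k b"
  let ?v = "\<lambda>b. (v \<bullet> b / t) ^ k b" and ?w = "\<lambda>b. (w \<bullet> b / t) ^ k b"
  have le1: "\<bar>v \<bullet> b / t\<bar> \<le> 1" "\<bar>w \<bullet> b / t\<bar> \<le> 1" if "b \<in> Basis" for b
    using v[OF that] w[OF that] t by (auto simp: abs_if field_simps split: if_splits)
  have scale: "(\<Prod>b\<in>Basis. (u \<bullet> b) ^ k b) = t ^ ?n * (\<Prod>b\<in>Basis. (u \<bullet> b / t) ^ k b)" for u :: 'a
    using t by (simp add: power_sum prod.distrib[symmetric] power_divide)
  have "\<bar>(\<Prod>b\<in>Basis. ?v b) - (\<Prod>b\<in>Basis. ?w b)\<bar> \<le> (\<Sum>b\<in>Basis. \<bar>?v b - ?w b\<bar>)"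
    unfolding real_norm_def[symmetric]
    by (rule norm_prod_diff) (use le1 in \<open>auto simp: power_abs intro!: power_le_one\<close>)
  also have "\<dots> \<le> (\<Sum>b\<in>Basis. real (k b) * (norm (v - w) / t))"
  proof (rule sum_mono)
    fix b :: 'a assume b: "b \<in> Basis"
    have "\<bar>?v b - ?w b\<bar> \<le> real (k b) * \<bar>v \<bullet> b / t - w \<bullet> b / t\<bar>"
      using norm_power_diff[of "v \<bullet> b / t" "w \<bullet> b / t" "k b"] le1[OF b] by simp
    also have "\<bar>v \<bullet> b / t - w \<bullet> b / t\<bar> = \<bar>(v - w) \<bullet> b\<bar> / t"
      using t by (simp add: inner_diff_left diff_divide_distrib[symmetric])
    also have "\<dots> \<le> norm (v - w) / t"
      using t Basis_le_norm[OF b, of "v - w"] by (simp add: divide_right_mono)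
    finally show "\<bar>?v b - ?w b\<bar> \<le> real (k b) * (norm (v - w) / t)"
      by (simp add: mult_left_mono)
  qed
  also have "\<dots> = real ?n * (norm (v - w) / t)"
    unfolding of_nat_sum sum_distrib_right ..
  also have "\<dots> \<le> 2 ^ ?n * (norm (v - w) / t)"
  proof (rule mult_right_mono)
    show "real ?n \<le> 2 ^ ?n"
      using of_nat_less_two_power[of ?n, where 'a = real] by linarith
  qed (use t in simp)
  finally have "\<bar>(\<Prod>b\<in>Basis. ?v b) - (\<Prod>b\<in>Basis. ?w b)\<bar> \<le> 2 ^ ?n * (norm (v - w) / t)" .
  then have "t ^ ?n * \<bar>(\<Prod>b\<in>Basis. ?v b) - (\<Prod>b\<in>Basis. ?w b)\<bar> \<le> t ^ ?n * (2 ^ ?n * (norm (v - w) / t))"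
    using t by (intro mult_left_mono) auto
  then show ?thesis
    unfolding scale right_diff_distrib[symmetric] using t
    by (simp add: abs_mult power_mult_distrib mult_ac)
qed

lemma prod_Basis_pair:
  fixes f :: "'a::euclidean_space \<times> 'b::euclidean_space \<Rightarrow> 'c::comm_monoid_mult"
  shows "(\<Prod>b\<in>Basis. f b) = (\<Prod>b\<in>Basis. f (b, 0)) * (\<Prod>b\<in>Basis. f (0, b))"
  unfolding Basis_prod_def
  by (subst prod.union_disjoint) (auto simp: prod.reindex inj_on_def)

lemma sum_Basis_pair:
  fixes f :: "'a::euclidean_space \<times> 'b::euclidean_space \<Rightarrow> 'c::comm_monoid_add"
  shows "(\<Sum>b\<in>Basis. f b) = (\<Sum>b\<in>Basis. f (b, 0)) + (\<Sum>b\<in>Basis. f (0, b))"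
  unfolding Basis_prod_def
  by (subst sum.union_disjoint) (auto simp: sum.reindex inj_on_def)

lemma finite_PiE_sum_less:
  assumes "finite S"
  shows "finite {i \<in> S \<rightarrow>\<^sub>E (UNIV :: nat set). (\<Sum>b\<in>S. i b) < m}"
proof (rule finite_subset)
  show "{i \<in> S \<rightarrow>\<^sub>E UNIV. (\<Sum>b\<in>S. i b) < m} \<subseteq> S \<rightarrow>\<^sub>E {..<m}"
  proof (clarsimp simp: PiE_iff)
    fix i b assume "(\<Sum>b\<in>S. i b) < m" "b \<in> S"
    moreover have "i b \<le> (\<Sum>b\<in>S. i b)"
      using assms \<open>b \<in> S\<close> by (intro member_le_sum) auto
    ultimately show "i b < m" by linarith
  qed
  show "finite (S \<rightarrow>\<^sub>E {..<m})"
    using assms by (intro finite_PiE) auto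
qed

lemma poly2_prod_power_inner:
  assumes "(\<Sum>b\<in>Basis. k b) \<le> m"
  shows "poly2 m (\<lambda>z :: real ^ 2. \<Prod>b\<in>Basis. ((z - p) \<bullet> b) ^ k b)"
proof -
  have "poly2 (\<Sum>b\<in>Basis. k b * 1) (\<lambda>z :: real ^ 2. \<Prod>b\<in>Basis. ((z - p) \<bullet> b) ^ k b)"
    by (rule poly2_prod[OF finite_Basis poly2_power[OF poly2_inner]])
  then show ?thesis
    using assms poly2_mono by simp
qed

text \<open>Truncating the power series at the base point gives polynomials which approximate well even
  relative to displacements between arbitrary nearby points, so the series never has to be
  recentred.\<close>

lemma analytic_mixdiff_approx:
  fixes g :: "(real ^ 2) \<times> (real ^ 2) \<Rightarrow> real"
  assumes "real_analytic_on_open U g" "(p, q) \<in> U"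
  shows "\<exists>\<delta>>0. \<exists>C\<ge>0. \<forall>m. \<exists>P. mixdiff_approx (\<lambda>x \<xi>. g (x, \<xi>)) (ball p \<delta>) (ball q \<delta>) (C / 2 ^ m) m P"
proof -
  let ?B = "Basis :: ((real ^ 2) \<times> (real ^ 2)) set"
  let ?I = "?B \<rightarrow>\<^sub>E (UNIV :: nat set)"
  obtain a \<rho> where \<rho>: "\<rho> > 0" and series: "\<And>y. y \<in> ball (p, q) \<rho> \<Longrightarrow>
      ((\<lambda>i. a i * (\<Prod>b\<in>?B. ((y - (p, q)) \<bullet> b) ^ i b)) has_sum g y) ?I"
    using assms unfolding real_analytic_on_open_def by meson
  \<comment> \<open>There are four basis vectors, so the corner of the cube of half-width
    \<open>s\<close> lies within 4s < \<rho> of the base point. The choice of \<open>t\<close> gives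
    2t = s/2, which leaves a factor \<open>1 / 2 ^ n i\<close> after the doubling of the radius in
    the Lipschitz bound.\<close>
  define s where "s = \<rho> / 5"
  define t where "t = s / 4"
  have s: "s > 0" and t: "t > 0" using \<rho> by (auto simp: s_def t_def)
  define X where "X = (\<lambda>i :: (real ^ 2) \<times> (real ^ 2) \<Rightarrow> nat. \<lambda>x. \<Prod>b\<in>Basis. ((x - p) \<bullet> b) ^ i (b, 0))"
  define Y where "Y = (\<lambda>i :: (real ^ 2) \<times> (real ^ 2) \<Rightarrow> nat. \<lambda>\<xi>. \<Prod>b\<in>Basis. ((\<xi> - q) \<bullet> b) ^ i (0, b))"
  define n where "n = (\<lambda>i :: (real ^ 2) \<times> (real ^ 2) \<Rightarrow> nat. \<Sum>b\<in>?B. i b)"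
  have XY: "((\<lambda>i. a i * (X i x * Y i \<xi>)) has_sum g (x, \<xi>)) ?I" if "x \<in> ball p t" "\<xi> \<in> ball q t" for x \<xi>
  proof -
    have "dist (p, q) (x, \<xi>) \<le> dist p x + dist q \<xi>"
      unfolding dist_prod_def by (simp add: sqrt_sum_squares_le_sum)
    also have "\<dots> < \<rho>" using that s by (auto simp: t_def s_def)
    finally show ?thesis
      using series[of "(x, \<xi>)"] by (simp add: prod_Basis_pair X_def Y_def)
  qed
  \<comment> \<open>The series is evaluated at this corner, where the monomial of index
    \<open>i\<close> equals \<open>s ^ n i\<close>. Unconditional convergence of a real series is
    absolute, so the coefficients decay geometrically.\<close>
  have "norm (s *\<^sub>R (\<Sum>?B)) < \<rho>"
  proof -
    have "norm (\<Sum>?B) \<le> (\<Sum>b\<in>?B. norm b)" by (rule norm_sum)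
    also have "\<dots> = 4" by simp
    finally have "s * norm (\<Sum>?B) \<le> s * 4" using s by (intro mult_left_mono) auto
    then show ?thesis using s \<rho> by (simp add: s_def)
  qed
  then have "(p, q) + s *\<^sub>R (\<Sum>?B) \<in> ball (p, q) \<rho>"
    by (simp add: dist_norm)
  from series[OF this] have "(\<lambda>i. a i * (\<Prod>b\<in>?B. ((s *\<^sub>R (\<Sum>?B)) \<bullet> b) ^ i b)) summable_on ?I"
    unfolding summable_on_def by auto
  also have "(\<lambda>i. a i * (\<Prod>b\<in>?B. ((s *\<^sub>R (\<Sum>?B)) \<bullet> b) ^ i b)) = (\<lambda>i. a i * s ^ n i)"
    by (auto simp: n_def power_sum inner_sum_left inner_Basis intro!: ext prod.cong arg_cong[of _ _ "(*) _"])
  finally have "(\<lambda>i. \<bar>a i\<bar> * s ^ n i) summable_on ?I"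
    using s by (subst (asm) summable_on_iff_abs_summable_on_real) (simp add: abs_mult)
  then obtain S where S: "((\<lambda>i. \<bar>a i\<bar> * s ^ n i) has_sum S) ?I"
    unfolding summable_on_def by blast
  have S0: "S \<ge> 0"
    by (rule has_sum_nonneg[OF S]) (use s in auto)
  show ?thesis
  proof (rule exI[of _ t], rule conjI[OF t], rule exI[of _ "S / t\<^sup>2"], rule conjI, goal_cases)
    case 1
    show ?case using S0 by simp
  next
    case 2
    show ?case
    proof
      fix m
      let ?J = "{i \<in> ?I. n i < m}"
      define P where "P = (\<lambda>x \<xi>. \<Sum>i\<in>?J. a i * (X i x * Y i \<xi>))"
      have fin: "finite ?J" unfolding n_def by (rule finite_PiE_sum_less) simp
      have n_eq: "n i = (\<Sum>b\<in>Basis. i (b, 0)) + (\<Sum>b\<in>Basis. i (0, b))" for i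
        unfolding n_def by (rule sum_Basis_pair)
      have pX: "poly2 m (X i)" and pY: "poly2 m (Y i)" if "i \<in> ?J" for i
        using that unfolding X_def Y_def by (auto intro!: poly2_prod_power_inner simp: n_eq)
      have P1: "poly2 m (P x)" for x
        unfolding P_def
        by (rule poly2_sum, rule poly2_cmult, rule poly2_cmult, rule pY)
      have P2: "poly2 m (\<lambda>x. P x \<xi>)" for \<xi>
        unfolding P_def
        by (rule poly2_sum, rule poly2_cmult, subst mult.commute, rule poly2_cmult, rule pX)
      have bound: "\<bar>mixdiff (\<lambda>x \<xi>. g (x, \<xi>) - P x \<xi>) x y \<xi> \<eta>\<bar> \<le> S / t\<^sup>2 / 2 ^ m * norm (x - y) * norm (\<xi> - \<eta>)"
        if x: "x \<in> ball p t" and y: "y \<in> ball p t" and \<xi>: "\<xi> \<in> ball q t" and \<eta>: "\<eta> \<in> ball q t" for x y \<xi> \<eta>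
      proof -
        \<comment> \<open>The mixed difference of a product of a function of x and a function of
          \<xi> is the product of the two differences. Each of the two Lipschitz bounds contributes
          one factor \<open>1 / t\<close> to \<open>D\<close>.\<close>
        define f where "f = (\<lambda>i. a i * ((X i x - X i y) * (Y i \<xi> - Y i \<eta>)))"
        define D where "D = norm (x - y) * norm (\<xi> - \<eta>) / t\<^sup>2"
        have "((\<lambda>i. a i * (X i x * Y i \<xi>) + - (a i * (X i y * Y i \<xi>)) + - (a i * (X i x * Y i \<eta>)) + a i * (X i y * Y i \<eta>))
          has_sum (g (x, \<xi>) + - g (y, \<xi>) + - g (x, \<eta>) + g (y, \<eta>))) ?I"
          using x y \<xi> \<eta> by (intro has_sum_add has_sum_uminusI XY)
        also have "(\<lambda>i. a i * (X i x * Y i \<xi>) + - (a i * (X i y * Y i \<xi>)) + - (a i * (X i x * Y i \<eta>)) + a i * (X i y * Y i \<eta>)) = f"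
          by (simp add: f_def algebra_simps)
        finally have 1: "(f has_sum mixdiff (\<lambda>x \<xi>. g (x, \<xi>)) x y \<xi> \<eta>) ?I"
          by (simp add: mixdiff_def)
        have "(f has_sum (\<Sum>i\<in>?J. f i)) ?J"
          using fin by simp
        also have "(\<Sum>i\<in>?J. f i) = mixdiff P x y \<xi> \<eta>"
          by (simp add: mixdiff_def P_def f_def sum_subtractf[symmetric] sum.distrib[symmetric] algebra_simps)
        finally have "(f has_sum (mixdiff (\<lambda>x \<xi>. g (x, \<xi>)) x y \<xi> \<eta> - mixdiff P x y \<xi> \<eta>)) (?I - ?J)"
          by (rule has_sum_Diff[OF 1]) auto
        then have 2: "(f has_sum mixdiff (\<lambda>x \<xi>. g (x, \<xi>) - P x \<xi>) x y \<xi> \<eta>) (?I - ?J)"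
          by (simp add: mixdiff_def algebra_simps)
        \<comment> \<open>The two Lipschitz factors combine to
          \<open>(2 * t) ^ n i = (s / 2) ^ n i\<close>. On the tail \<open>n i\<close> is at least
          \<open>m\<close>, so the surplus is at most \<open>1 / 2 ^ m\<close> and a term of the
          summable majorant remains.\<close>
        have fbound: "norm (f i) \<le> \<bar>a i\<bar> * s ^ n i * (D / 2 ^ m)" if "i \<in> ?I - ?J" for i
        proof -
          have m: "m \<le> n i" using that by auto
          have xb: "\<bar>(z - p) \<bullet> b\<bar> \<le> t" if "z \<in> ball p t" "b \<in> Basis" for z b
            using Basis_le_norm[OF that(2), of "z - p"] that(1) by (simp add: dist_norm norm_minus_commute)
          have \<xi>b: "\<bar>(z - q) \<bullet> b\<bar> \<le> t" if "z \<in> ball q t" "b \<in> Basis" for z b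
            using Basis_le_norm[OF that(2), of "z - q"] that(1) by (simp add: dist_norm norm_minus_commute)
          have X: "\<bar>X i x - X i y\<bar> \<le> (2 * t) ^ (\<Sum>b\<in>Basis. i (b, 0)) / t * norm (x - y)"
            using prod_power_inner_lipschitz[OF t xb[OF x] xb[OF y], of "\<lambda>b. i (b, 0)"] by (simp add: X_def)
          have Y: "\<bar>Y i \<xi> - Y i \<eta>\<bar> \<le> (2 * t) ^ (\<Sum>b\<in>Basis. i (0, b)) / t * norm (\<xi> - \<eta>)"
            using prod_power_inner_lipschitz[OF t \<xi>b[OF \<xi>] \<xi>b[OF \<eta>], of "\<lambda>b. i (0, b)"] by (simp add: Y_def)
          have "\<bar>(X i x - X i y) * (Y i \<xi> - Y i \<eta>)\<bar>
             \<le> ((2 * t) ^ (\<Sum>b\<in>Basis. i (b, 0)) / t * norm (x - y)) * ((2 * t) ^ (\<Sum>b\<in>Basis. i (0, b)) / t * norm (\<xi> - \<eta>))"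
            unfolding abs_mult using X Y t by (intro mult_mono) auto
          also have "\<dots> = (2 * t) ^ n i * D"
            by (simp add: n_eq power_add D_def power2_eq_square)
          also have "2 * t = s / 2" by (simp add: t_def)
          also have "(s / 2) ^ n i * D = s ^ n i * (D / 2 ^ n i)"
            by (simp add: power_divide)
          also have "\<dots> \<le> s ^ n i * (D / 2 ^ m)"
            using m s t by (intro mult_left_mono divide_left_mono power_increasing) (auto simp: D_def)
          finally show ?thesis
            unfolding f_def real_norm_def abs_mult[of "a i"] mult.assoc
            by (intro mult_left_mono) auto
        qed
        have "((\<lambda>i. \<bar>a i\<bar> * s ^ n i * (D / 2 ^ m)) has_sum (S * (D / 2 ^ m))) ?I"
          by (rule has_sum_cmult_left[OF S])
        moreover from this have "(\<lambda>i. \<bar>a i\<bar> * s ^ n i * (D / 2 ^ m)) summable_on (?I - ?J)"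
          by (meson summable_on_def summable_on_subset_banach Diff_subset)
        then obtain T where T: "((\<lambda>i. \<bar>a i\<bar> * s ^ n i * (D / 2 ^ m)) has_sum T) (?I - ?J)"
          unfolding summable_on_def by blast
        ultimately have "T \<le> S * (D / 2 ^ m)"
          using s by (intro has_sum_mono2[OF T]) (auto simp: D_def)
        moreover have "norm (mixdiff (\<lambda>x \<xi>. g (x, \<xi>) - P x \<xi>) x y \<xi> \<eta>) \<le> T"
          by (rule norm_infsum_le[OF 2 T fbound])
        ultimately show ?thesis
          by (simp add: D_def mult_ac)
      qed
      show "\<exists>P. mixdiff_approx (\<lambda>x \<xi>. g (x, \<xi>)) (ball p t) (ball q t) (S / t\<^sup>2 / 2 ^ m) m P"
        by (rule exI, rule mixdiff_approxI, rule P1, rule P2, rule bound)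
    qed
  qed
qed

section \<open>Uniform constants on compact sets\<close>

text \<open>\<open>\<delta>\<close> and \<open>C\<close> serve all base points and all orders
  \<open>m\<close>, whereas the polynomial may change with them. Intersecting with the two sets is
  necessary because a local extension is tied to the function only there.\<close>

definition uniformly_approximable ::
    "(real ^ 2 \<Rightarrow> real ^ 2 \<Rightarrow> real) \<Rightarrow> (real ^ 2) set \<Rightarrow> (real ^ 2) set \<Rightarrow> real \<Rightarrow> real \<Rightarrow> bool" where
  "uniformly_approximable F K\<^sub>1 K\<^sub>2 \<delta> C \<longleftrightarrow>
     (\<forall>p\<in>K\<^sub>1. \<forall>q\<in>K\<^sub>2. \<forall>m. \<exists>P. mixdiff_approx F (K\<^sub>1 \<inter> ball p \<delta>) (K\<^sub>2 \<inter> ball q \<delta>) (C / 2 ^ m) m P)"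

lemma uniformly_approximable_swap:
  assumes "uniformly_approximable F K\<^sub>1 K\<^sub>2 \<delta> C"
  shows "uniformly_approximable (\<lambda>\<xi> x. F x \<xi>) K\<^sub>2 K\<^sub>1 \<delta> C"
  unfolding uniformly_approximable_def
proof (intro ballI allI)
  fix q p m
  assume "q \<in> K\<^sub>2" "p \<in> K\<^sub>1"
  then obtain P where "mixdiff_approx F (K\<^sub>1 \<inter> ball p \<delta>) (K\<^sub>2 \<inter> ball q \<delta>) (C / 2 ^ m) m P"
    using assms unfolding uniformly_approximable_def by blast
  then show "\<exists>P. mixdiff_approx (\<lambda>\<xi> x. F x \<xi>) (K\<^sub>2 \<inter> ball q \<delta>) (K\<^sub>1 \<inter> ball p \<delta>) (C / 2 ^ m) m P"
    by (blast dest: mixdiff_approx_swap)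
qed

lemma dist_Pair_le: "dist (p, q) (x, \<xi>) \<le> dist p x + dist q \<xi>"
  unfolding dist_prod_def by (simp add: sqrt_sum_squares_le_sum)

text \<open>A Lebesgue number argument: local radii and constants exist at each point of the compact
  product, and finitely many of them suffice.\<close>

lemma real_analytic_on_uniformly_approximable:
  fixes F :: "real ^ 2 \<Rightarrow> real ^ 2 \<Rightarrow> real"
  assumes F: "real_analytic_on S (\<lambda>(x, \<xi>). F x \<xi>)"
    and K: "compact K\<^sub>1" "compact K\<^sub>2" "K\<^sub>1 \<times> K\<^sub>2 \<subseteq> S"
  shows "\<exists>\<delta>>0. \<exists>C\<ge>0. uniformly_approximable F K\<^sub>1 K\<^sub>2 \<delta> C"
proof -
  let ?good = "\<lambda>z \<delta> C. \<forall>m. \<exists>P. mixdiff_approx F (K\<^sub>1 \<inter> ball (fst z) \<delta>) (K\<^sub>2 \<inter> ball (snd z) \<delta>) (C / 2 ^ m) m P"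
  have "\<exists>\<delta> C. \<delta> > 0 \<and> C \<ge> 0 \<and> ?good z \<delta> C" if z: "z \<in> K\<^sub>1 \<times> K\<^sub>2" for z
  proof -
    obtain p q where pq: "z = (p, q)" by (cases z)
    have "z \<in> S" using z K(3) by blast
    then obtain U g where U: "open U" "(p, q) \<in> U" "real_analytic_on_open U g"
      and g: "\<forall>y\<in>U \<inter> S. g y = (case y of (x, \<xi>) \<Rightarrow> F x \<xi>)"
      using F unfolding extends_locally_def pq by meson
    obtain \<delta> C where \<delta>: "\<delta> > 0" and C: "C \<ge> 0"
      and P: "\<And>m. \<exists>P. mixdiff_approx (\<lambda>x \<xi>. g (x, \<xi>)) (ball p \<delta>) (ball q \<delta>) (C / 2 ^ m) m P"
      using analytic_mixdiff_approx[OF U(3,2)] by auto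
    obtain e where e: "e > 0" "ball (p, q) e \<subseteq> U"
      using U(1,2) open_contains_ball by blast
    \<comment> \<open>Two balls of radius \<open>e / 2\<close> have their product inside the ball of
      radius \<open>e\<close>, where the extension \<open>g\<close> is available.\<close>
    define \<delta>' where "\<delta>' = min \<delta> (e / 2)"
    have gF: "F x \<xi> = g (x, \<xi>)" if "x \<in> K\<^sub>1 \<inter> ball p \<delta>'" "\<xi> \<in> K\<^sub>2 \<inter> ball q \<delta>'" for x \<xi>
    proof -
      have "dist (p, q) (x, \<xi>) < e"
        using dist_Pair_le[of p q x \<xi>] that by (auto simp: \<delta>'_def)
      then have "(x, \<xi>) \<in> U \<inter> S" using e(2) that K(3) by auto
      then show ?thesis using g by auto
    qed
    have "?good z \<delta>' C"
    proof
      fix m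
      obtain P where "mixdiff_approx (\<lambda>x \<xi>. g (x, \<xi>)) (ball p \<delta>) (ball q \<delta>) (C / 2 ^ m) m P"
        using P by blast
      then have "mixdiff_approx F (K\<^sub>1 \<inter> ball p \<delta>') (K\<^sub>2 \<inter> ball q \<delta>') (C / 2 ^ m) m P"
        by (rule mixdiff_approx_mono) (use gF in \<open>auto simp: \<delta>'_def\<close>)
      then show "\<exists>P. mixdiff_approx F (K\<^sub>1 \<inter> ball (fst z) \<delta>') (K\<^sub>2 \<inter> ball (snd z) \<delta>') (C / 2 ^ m) m P"
        unfolding pq fst_conv snd_conv by blast
    qed
    moreover have "\<delta>' > 0" using \<delta> e by (simp add: \<delta>'_def)
    ultimately show ?thesis using C by blast
  qed
  then have "\<forall>z\<in>K\<^sub>1 \<times> K\<^sub>2. \<exists>\<delta> C. \<delta> > 0 \<and> C \<ge> 0 \<and> ?good z \<delta> C" by blast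
  from bchoice[OF this] obtain d
    where "\<forall>z\<in>K\<^sub>1 \<times> K\<^sub>2. \<exists>C. d z > 0 \<and> C \<ge> 0 \<and> ?good z (d z) C" ..
  from bchoice[OF this] obtain c
    where dc: "\<forall>z\<in>K\<^sub>1 \<times> K\<^sub>2. d z > 0 \<and> c z \<ge> 0 \<and> ?good z (d z) (c z)" ..
  have d: "d z > 0" and c: "c z \<ge> 0" and good: "?good z (d z) (c z)" if "z \<in> K\<^sub>1 \<times> K\<^sub>2" for z
    using dc that by blast+
  \<comment> \<open>Covering by half radii leaves room: a point within \<open>d z / 2\<close> of
    \<open>z\<close> has its whole neighbourhood of radius up to \<open>d z / 2\<close>, in each
    factor, inside the ball of radius \<open>d z\<close>.\<close>
  obtain T where T: "T \<subseteq> K\<^sub>1 \<times> K\<^sub>2" "finite T" "K\<^sub>1 \<times> K\<^sub>2 \<subseteq> (\<Union>z\<in>T. ball z (d z / 2))"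
  proof (rule compactE_image[of "K\<^sub>1 \<times> K\<^sub>2" "K\<^sub>1 \<times> K\<^sub>2" "\<lambda>z. ball z (d z / 2)"])
    show "compact (K\<^sub>1 \<times> K\<^sub>2)" using K by (intro compact_Times)
    show "K\<^sub>1 \<times> K\<^sub>2 \<subseteq> (\<Union>z\<in>K\<^sub>1 \<times> K\<^sub>2. ball z (d z / 2))"
    proof
      fix z assume z: "z \<in> K\<^sub>1 \<times> K\<^sub>2"
      then show "z \<in> (\<Union>z\<in>K\<^sub>1 \<times> K\<^sub>2. ball z (d z / 2))"
        using d[OF z] by (intro UN_I[of z]) simp_all
    qed
  qed (simp, rule that)
  \<comment> \<open>The inserted 1 keeps the minimum defined and positive when \<open>T\<close> is
    empty. The sum \<open>C\<close> of nonnegative constants dominates each of them.\<close>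
  define \<delta> where "\<delta> = Min (insert 1 ((\<lambda>z. d z / 2) ` T))"
  define C where "C = (\<Sum>z\<in>T. c z)"
  have "\<delta> > 0" unfolding \<delta>_def using T d by (subst Min_gr_iff) auto
  moreover have "C \<ge> 0" unfolding C_def using T c by (intro sum_nonneg) auto
  moreover have "uniformly_approximable F K\<^sub>1 K\<^sub>2 \<delta> C"
    unfolding uniformly_approximable_def
  proof (intro ballI allI)
    fix p q m assume "p \<in> K\<^sub>1" "q \<in> K\<^sub>2"
    then obtain z where z: "z \<in> T" "dist z (p, q) < d z / 2" using T(3) by auto
    have "d z / 2 \<ge> \<delta>" unfolding \<delta>_def using T(2) z by (intro Min_le) auto
    moreover have "dist (fst z) p \<le> dist z (p, q)" "dist (snd z) q \<le> dist z (p, q)"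
      using dist_fst_le[of z "(p, q)"] dist_snd_le[of z "(p, q)"] by auto
    ultimately have "dist (fst z) p + \<delta> \<le> d z" "dist (snd z) q + \<delta> \<le> d z"
      using z(2) by linarith+
    then have sub: "ball p \<delta> \<subseteq> ball (fst z) (d z)" "ball q \<delta> \<subseteq> ball (snd z) (d z)"
      by (simp_all add: ball_subset_ball_iff dist_commute)
    have "z \<in> K\<^sub>1 \<times> K\<^sub>2" using T(1) z(1) by blast
    then obtain P where P: "mixdiff_approx F (K\<^sub>1 \<inter> ball (fst z) (d z)) (K\<^sub>2 \<inter> ball (snd z) (d z)) (c z / 2 ^ m) m P"
      using good[THEN spec, of z m] by blast
    have "c z \<le> C" unfolding C_def using T c z(1) by (intro member_le_sum) auto
    then have "mixdiff_approx F (K\<^sub>1 \<inter> ball p \<delta>) (K\<^sub>2 \<inter> ball q \<delta>) (C / 2 ^ m) m P"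
      using sub by (intro mixdiff_approx_mono[OF P]) (auto simp: divide_right_mono)
    then show "\<exists>P. mixdiff_approx F (K\<^sub>1 \<inter> ball p \<delta>) (K\<^sub>2 \<inter> ball q \<delta>) (C / 2 ^ m) m P" by (rule exI[of _ P])
  qed
  ultimately show ?thesis by blast
qed

section \<open>Subdivision of a long displacement\<close>

lemma poly2_mixdiff:
  assumes "\<And>x. poly2 m (P x)"
  shows "poly2 m (\<lambda>\<xi>. mixdiff P x y \<xi> \<eta>)"
  unfolding mixdiff_def by (intro poly2_add poly2_diff assms poly2_const_le)

text \<open>The segment is cut into \<open>n\<close> pieces shorter than \<open>\<delta>\<close>,
  each with its own local polynomial. The mixed difference telescopes over the pieces, and since
  each error is proportional to the length of its piece, the total error is proportional to
  \<open>norm (x - y)\<close> with the same constant.\<close>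

lemma mixdiff_segment_approx:
  assumes F: "uniformly_approximable F K\<^sub>1 K\<^sub>2 \<delta> C" and \<delta>: "\<delta> > 0"
    and seg: "closed_segment y x \<subseteq> K\<^sub>1" and n: "norm (x - y) < real n * \<delta>"
    and c: "c \<in> K\<^sub>2"
  shows "\<exists>Q. poly2 m Q \<and> (\<forall>\<xi>\<in>K\<^sub>2 \<inter> ball c \<delta>. \<bar>mixdiff F x y \<xi> c - Q \<xi>\<bar> \<le> C / 2 ^ m * norm (x - y) * norm (\<xi> - c))"
proof -
  define u where "u k = y + (real k / real n) *\<^sub>R (x - y)" for k
  have n0: "n > 0" using n \<delta> by (cases n) auto
  have u: "u k \<in> K\<^sub>1" if "k \<le> n" for k
  proof -
    have "u k = (1 - real k / real n) *\<^sub>R y + (real k / real n) *\<^sub>R x"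
      by (simp add: u_def algebra_simps)
    then have "u k \<in> closed_segment y x"
      unfolding in_segment using that n0 by (intro exI[of _ "real k / real n"]) auto
    then show ?thesis using seg by blast
  qed
  have step: "norm (u (Suc k) - u k) = norm (x - y) / n" for k
  proof -
    have "u (Suc k) - u k = (real (Suc k) / real n - real k / real n) *\<^sub>R (x - y)"
      by (simp add: u_def scaleR_left_diff_distrib)
    also have "real (Suc k) / real n - real k / real n = 1 / real n"
      by (simp add: diff_divide_distrib[symmetric])
    finally show ?thesis by simp
  qed
  have near: "u (Suc k) \<in> K\<^sub>1 \<inter> ball (u k) \<delta>" "u k \<in> K\<^sub>1 \<inter> ball (u k) \<delta>" if "k < n" for k
  proof -
    have "norm (u (Suc k) - u k) < \<delta>"
      unfolding step using n n0 by (simp add: divide_less_eq mult.commute)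
    then show "u (Suc k) \<in> K\<^sub>1 \<inter> ball (u k) \<delta>" "u k \<in> K\<^sub>1 \<inter> ball (u k) \<delta>"
      using u[of k] u[of "Suc k"] that \<delta> by (simp_all add: dist_norm norm_minus_commute)
  qed
  have "\<forall>k\<in>{..<n}. \<exists>P. mixdiff_approx F (K\<^sub>1 \<inter> ball (u k) \<delta>) (K\<^sub>2 \<inter> ball c \<delta>) (C / 2 ^ m) m P"
    using F u c unfolding uniformly_approximable_def by simp
  from bchoice[OF this] obtain P where
    P: "\<And>k. k < n \<Longrightarrow> mixdiff_approx F (K\<^sub>1 \<inter> ball (u k) \<delta>) (K\<^sub>2 \<inter> ball c \<delta>) (C / 2 ^ m) m (P k)"
    by auto
  have P1: "poly2 m (P k x)" if "k < n" for k x
    by (rule mixdiff_approx_poly(1)[OF P[OF that]])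
  have P2: "\<bar>mixdiff (\<lambda>x \<xi>. F x \<xi> - P k x \<xi>) (u (Suc k)) (u k) \<xi> c\<bar>
      \<le> C / 2 ^ m * norm (u (Suc k) - u k) * norm (\<xi> - c)" if "k < n" "\<xi> \<in> K\<^sub>2 \<inter> ball c \<delta>" for k \<xi>
    using mixdiff_approxD[OF P[OF that(1)] near[OF that(1)] that(2)] c \<delta> by simp
  \<comment> \<open>The first arguments are the fixed nodes, so \<open>Q\<close> has degree
    \<open>m\<close> in \<xi> even though the polynomials of neighbouring pieces are
    unrelated.\<close>
  define Q where "Q \<xi> = (\<Sum>k<n. mixdiff (P k) (u (Suc k)) (u k) \<xi> c)" for \<xi>
  have "poly2 m Q"
    unfolding Q_def by (rule poly2_sum, rule poly2_mixdiff, rule P1) simp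
  moreover have "\<bar>mixdiff F x y \<xi> c - Q \<xi>\<bar> \<le> C / 2 ^ m * norm (x - y) * norm (\<xi> - c)" if \<xi>: "\<xi> \<in> K\<^sub>2 \<inter> ball c \<delta>" for \<xi>
  proof -
    have "(\<Sum>k<n. mixdiff F (u (Suc k)) (u k) \<xi> c)
        = (\<Sum>k<n. (F (u (Suc k)) \<xi> - F (u (Suc k)) c) - (F (u k) \<xi> - F (u k) c))"
      by (simp add: mixdiff_def algebra_simps)
    also have "\<dots> = mixdiff F (u n) (u 0) \<xi> c"
      by (subst sum_lessThan_telescope) (simp add: mixdiff_def)
    also have "\<dots> = mixdiff F x y \<xi> c" using n0 by (simp add: u_def)
    finally have "mixdiff F x y \<xi> c - Q \<xi>
        = (\<Sum>k<n. mixdiff F (u (Suc k)) (u k) \<xi> c - mixdiff (P k) (u (Suc k)) (u k) \<xi> c)"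
      unfolding Q_def sum_subtractf by simp
    also have "\<dots> = (\<Sum>k<n. mixdiff (\<lambda>x \<xi>. F x \<xi> - P k x \<xi>) (u (Suc k)) (u k) \<xi> c)"
      by (intro sum.cong) (simp_all add: mixdiff_def)
    also have "\<bar>\<dots>\<bar> \<le> (\<Sum>k<n. \<bar>mixdiff (\<lambda>x \<xi>. F x \<xi> - P k x \<xi>) (u (Suc k)) (u k) \<xi> c\<bar>)"
      by (rule sum_abs)
    also have "\<dots> \<le> (\<Sum>k<n. C / 2 ^ m * (norm (x - y) / n) * norm (\<xi> - c))"
      using P2[OF _ \<xi>] by (intro sum_mono) (simp add: step)
    also have "\<dots> = C / 2 ^ m * norm (x - y) * norm (\<xi> - c)"
      using n0 by simp
    finally show ?thesis .
  qed
  ultimately show ?thesis by blast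
qed

text \<open>The case of order 0: the approximant is constant, and it vanishes because at \<xi> = c
  both the mixed difference and the error bound are zero.\<close>

lemma mixdiff_segment_bound:
  assumes F: "uniformly_approximable F K\<^sub>1 K\<^sub>2 \<delta> C" and \<delta>: "\<delta> > 0"
    and seg: "closed_segment y x \<subseteq> K\<^sub>1" and n: "norm (x - y) < real n * \<delta>"
    and c: "c \<in> K\<^sub>2" and \<xi>: "\<xi> \<in> K\<^sub>2 \<inter> ball c \<delta>"
  shows "\<bar>mixdiff F x y \<xi> c\<bar> \<le> C * norm (x - y) * norm (\<xi> - c)"
proof -
  obtain Q where Q: "poly2 0 Q" "\<forall>\<xi>\<in>K\<^sub>2 \<inter> ball c \<delta>. \<bar>mixdiff F x y \<xi> c - Q \<xi>\<bar> \<le> C / 2 ^ 0 * norm (x - y) * norm (\<xi> - c)"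
    using mixdiff_segment_approx[OF F \<delta> seg n c, of 0] by blast
  have "c \<in> K\<^sub>2 \<inter> ball c \<delta>" using c \<delta> by simp
  from Q(2)[rule_format, OF this] have "\<bar>mixdiff F x y c c - Q c\<bar> \<le> 0" by simp
  then have "Q c = 0" by (simp add: mixdiff_def)
  then have "Q \<xi> = 0" using poly2_0_const[OF Q(1), of \<xi> c] by simp
  then show ?thesis using Q(2)[rule_format, OF \<xi>] by simp
qed

subsection \<open>Exponentials of approximately polynomial phases\<close>

lemma exp_ge_power_over_fact:
  fixes x :: real
  assumes "x \<ge> 0"
  shows "x ^ n / fact n \<le> exp x"
proof -
  have "(\<Sum>k\<in>{n}. x ^ k /\<^sub>R fact k) \<le> exp x"
    unfolding exp_def using assms by (intro sum_le_suminf summable_exp_generic) auto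
  then show ?thesis by (simp add: divide_inverse mult.commute)
qed

text \<open>The argument has real part 0, so the remainder carries no exponential factor. Writing
  \<open>L ^ n\<close> as \<open>(2 * L) ^ n / 2 ^ n\<close> and bounding
  \<open>(2 * L) ^ n / fact n\<close> by \<open>exp (2 * L)\<close> trades the factorial for the
  geometric rate used elsewhere.\<close>

lemma Taylor_exp_imaginary:
  assumes "\<bar>\<theta>\<bar> \<le> L"
  shows "cmod (exp (\<i> * of_real \<theta>) - (\<Sum>k\<le>n. (\<i> * of_real \<theta>) ^ k / fact k)) \<le> L * exp (2 * L) / 2 ^ n"
proof -
  have L: "L \<ge> 0" using assms by linarith
  have "cmod (exp (\<i> * of_real \<theta>) - (\<Sum>k\<le>n. (\<i> * of_real \<theta>) ^ k / fact k)) \<le> \<bar>\<theta>\<bar> ^ Suc n / fact n"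
    using Taylor_exp[of "\<i> * of_real \<theta>" n] by (simp add: norm_mult)
  also have "\<dots> \<le> L ^ Suc n / fact n"
    using assms by (intro divide_right_mono power_mono) auto
  also have "\<dots> = L * ((2 * L) ^ n / fact n) / 2 ^ n"
    by (simp add: power_mult_distrib)
  also have "\<dots> \<le> L * exp (2 * L) / 2 ^ n"
    using L by (intro divide_right_mono mult_left_mono exp_ge_power_over_fact) auto
  finally show ?thesis .
qed

lemma norm_exp_imaginary_diff_le: "cmod (exp (\<i> * of_real a) - exp (\<i> * of_real b)) \<le> \<bar>a - b\<bar>"
proof -
  have "exp (\<i> * of_real a) - exp (\<i> * of_real b) = exp (\<i> * of_real b) * (exp (\<i> * of_real (a - b)) - 1)"
    by (simp add: right_diff_distrib exp_add[symmetric])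
  then have "cmod (exp (\<i> * of_real a) - exp (\<i> * of_real b)) = 2 * \<bar>sin ((a - b) / 2)\<bar>"
    by (simp only: norm_mult norm_exp_i_times dist_exp_i_1 mult_1)
  also have "\<dots> \<le> \<bar>a - b\<bar>"
    using abs_sin_x_le_abs_x[of "(a - b) / 2"] by simp
  finally show ?thesis .
qed

text \<open>The pair (i, j) receives the number i(d+1) + j + 1; the shift by one matches sums that
  start at t = 1, and division of t - 1 by d + 1 recovers the pair.\<close>

lemma sum_square_enumerate:
  fixes f :: "nat \<Rightarrow> nat \<Rightarrow> 'a::comm_monoid_add"
  shows "(\<Sum>(i, j)\<in>{..d} \<times> {..d}. f i j) = (\<Sum>t=1..(Suc d)\<^sup>2. f ((t - 1) div Suc d) ((t - 1) mod Suc d))"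
proof (rule sum.reindex_bij_witness[where i = "\<lambda>t. ((t - 1) div Suc d, (t - 1) mod Suc d)" and j = "\<lambda>(i, j). Suc (i * Suc d + j)"])
  fix t assume t: "t \<in> {1..(Suc d)\<^sup>2}"
  then have "t - 1 < Suc d * Suc d"
    by (simp only: power2_eq_square atLeastAtMost_iff) linarith
  then have "(t - 1) div Suc d < Suc d"
    by (rule less_mult_imp_div_less)
  then show "((t - 1) div Suc d, (t - 1) mod Suc d) \<in> {..d} \<times> {..d}"
    using mod_less_divisor[of "Suc d" "t - 1"] by (simp only: mem_Times_iff fst_conv snd_conv atMost_iff less_Suc_eq_le zero_less_Suc)
  show "(case ((t - 1) div Suc d, (t - 1) mod Suc d) of (i, j) \<Rightarrow> Suc (i * Suc d + j)) = t"
    using t div_mult_mod_eq[of "t - 1" "Suc d"] by (simp only: prod.case) simp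
next
  fix p assume "p \<in> {..d} \<times> {..d}"
  then obtain i j where p: "p = (i, j)" "i \<le> d" "j < Suc d" by auto
  have dm: "(i * Suc d + j) div Suc d = i" "(i * Suc d + j) mod Suc d = j"
    using p(3) by (simp_all only: div_mult_self3 mod_mult_self3 div_less mod_less)
  have "i * Suc d + j < Suc i * Suc d" using p(3) by simp
  also have "\<dots> \<le> Suc d * Suc d" using p(2) by (intro mult_le_mono1) simp
  finally show "(case p of (i, j) \<Rightarrow> Suc (i * Suc d + j)) \<in> {1..(Suc d)\<^sup>2}"
    by (simp only: p(1) prod.case power2_eq_square atLeastAtMost_iff) simp
  show "(((case p of (i, j) \<Rightarrow> Suc (i * Suc d + j)) - 1) div Suc d, ((case p of (i, j) \<Rightarrow> Suc (i * Suc d + j)) - 1) mod Suc d) = p"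
    by (simp only: p(1) prod.case diff_Suc_1 dm)
  show "f (((case p of (i, j) \<Rightarrow> Suc (i * Suc d + j)) - 1) div Suc d)
      (((case p of (i, j) \<Rightarrow> Suc (i * Suc d + j)) - 1) mod Suc d) = (case p of (i, j) \<Rightarrow> f i j)"
    by (simp only: p(1) prod.case diff_Suc_1 dm)
qed

text \<open>All dependence on \<open>u\<close> goes into the coefficients, chosen separately for
  each \<open>u\<close>, so either variable of the residue phase can play the role of
  \<open>z\<close>. In \<open>M\<close> the first summand pays for replacing \<open>G\<close> by its
  polynomial, the second for the Taylor remainder with L = 4 pi C.\<close>

lemma exp_phase_monomial_approx:
  fixes G :: "'u \<Rightarrow> real ^ 2 \<Rightarrow> real" and m :: nat
  assumes Q: "\<And>u. u \<in> A \<Longrightarrow> \<exists>Q. poly2 m Q \<and> (\<forall>z\<in>B. \<bar>G u z - Q z\<bar> \<le> C / 2 ^ m)"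
    and G: "\<And>u z. u \<in> A \<Longrightarrow> z \<in> B \<Longrightarrow> \<bar>G u z\<bar> \<le> C"
    and M: "M \<ge> 2 * pi * C + 4 * pi * C * exp (8 * pi * C)" and C: "C \<ge> 0"
  shows "\<exists>\<gamma>. \<forall>u\<in>A. \<forall>z\<in>B. cmod (exp (2 * of_real pi * \<i> * of_real (G u z)) -
      (\<Sum>t=1..(Suc (m * m))\<^sup>2. \<gamma> t u *
         of_real (mono2 c ((t - 1) div Suc (m * m)) ((t - 1) mod Suc (m * m)) z))) \<le> M / 2 ^ m"
proof -
  let ?T = "\<lambda>a z. \<Sum>t=1..(Suc (m * m))\<^sup>2. a ((t - 1) div Suc (m * m)) ((t - 1) mod Suc (m * m)) *
         of_real (mono2 c ((t - 1) div Suc (m * m)) ((t - 1) mod Suc (m * m)) z)"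
  have "\<exists>a. \<forall>z\<in>B. cmod (exp (2 * of_real pi * \<i> * of_real (G u z)) - ?T a z) \<le> M / 2 ^ m" if u: "u \<in> A" for u
  proof -
    obtain Q where Q: "poly2 m Q" and err: "\<And>z. z \<in> B \<Longrightarrow> \<bar>G u z - Q z\<bar> \<le> C / 2 ^ m"
      using Q[OF u] by blast
    \<comment> \<open>Powers of \<open>Q\<close> up to order \<open>m\<close> have degree at most
      \<open>m * m\<close>, hence \<open>(Suc (m * m))\<^sup>2\<close> monomials.\<close>
    define E where "E z = (\<Sum>k\<le>m. (\<i> * of_real (2 * pi * Q z)) ^ k / fact k)" for z
    have Ek: "E = (\<lambda>z. \<Sum>k\<le>m. ((2 * of_real pi * \<i>) ^ k / fact k) * of_real (Q z) ^ k)"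
      unfolding E_def by (intro ext sum.cong) (simp_all add: power_mult_distrib[symmetric] mult_ac)
    have "poly2 (m * m) E"
      unfolding Ek
    proof (rule poly2_sum, rule poly2_cmult)
      fix k assume "k \<in> {..m}"
      then show "poly2 (m * m) (\<lambda>z. complex_of_real (Q z) ^ k)"
        by (intro poly2_mono[OF poly2_power[OF poly2_of_real[OF Q]]]) simp
    qed
    then obtain a where a: "\<And>z. E z = (\<Sum>(i, j)\<in>{..m * m} \<times> {..m * m}. a i j * of_real (mono2 c i j z))"
      unfolding poly2_def by blast
    have "cmod (exp (2 * of_real pi * \<i> * of_real (G u z)) - ?T a z) \<le> M / 2 ^ m" if z: "z \<in> B" for z
    proof -
      \<comment> \<open>The polynomial is within \<open>C\<close> of a phase bounded by
        \<open>C\<close>, so it is bounded by 2C.\<close>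
      have "C / 2 ^ m \<le> C" using C by (simp add: divide_le_eq mult_le_cancel_left1)
      then have "\<bar>Q z\<bar> \<le> 2 * C" using err[OF z] G[OF u z] by linarith
      then have "\<bar>2 * pi * Q z\<bar> \<le> 4 * pi * C"
        by (simp add: abs_mult)
      then have 1: "cmod (exp (\<i> * of_real (2 * pi * Q z)) - E z) \<le> 4 * pi * C * exp (2 * (4 * pi * C)) / 2 ^ m"
        unfolding E_def by (rule Taylor_exp_imaginary)
      have "cmod (exp (\<i> * of_real (2 * pi * G u z)) - exp (\<i> * of_real (2 * pi * Q z))) \<le> \<bar>2 * pi * G u z - 2 * pi * Q z\<bar>"
        by (rule norm_exp_imaginary_diff_le)
      also have "\<dots> = 2 * pi * \<bar>G u z - Q z\<bar>"
        by (simp add: abs_mult right_diff_distrib[symmetric])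
      also have "\<dots> \<le> 2 * pi * (C / 2 ^ m)"
        using err[OF z] by (intro mult_left_mono) auto
      finally have "cmod (exp (\<i> * of_real (2 * pi * G u z)) - E z)
          \<le> 2 * pi * (C / 2 ^ m) + 4 * pi * C * exp (2 * (4 * pi * C)) / 2 ^ m"
        using 1 norm_triangle_ineq[of "exp (\<i> * of_real (2 * pi * G u z)) - exp (\<i> * of_real (2 * pi * Q z))"
            "exp (\<i> * of_real (2 * pi * Q z)) - E z"] by simp
      also have "\<dots> = (2 * pi * C + 4 * pi * C * exp (8 * pi * C)) / 2 ^ m"
        by (simp add: add_divide_distrib)
      also have "\<dots> \<le> M / 2 ^ m"
        using M by (intro divide_right_mono) auto
      also have "E z = ?T a z"
        unfolding a by (rule sum_square_enumerate)
      finally show ?thesis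
        by (simp add: mult_ac)
    qed
    then show ?thesis by blast
  qed
  then have "\<forall>u\<in>A. \<exists>a. \<forall>z\<in>B. cmod (exp (2 * of_real pi * \<i> * of_real (G u z)) - ?T a z) \<le> M / 2 ^ m"
    by blast
  from bchoice[OF this] obtain a where "\<forall>u\<in>A. \<forall>z\<in>B. cmod (exp (2 * of_real pi * \<i> * of_real (G u z)) - ?T (a u) z) \<le> M / 2 ^ m" ..
  then show ?thesis
    by (intro exI[of _ "\<lambda>t u. a u ((t - 1) div Suc (m * m)) ((t - 1) mod Suc (m * m))"])
qed

section \<open>Monomials and sizes of squares\<close>

lemma is_monomial_about_mono2:
  assumes "real (i + j) \<le> d"
  shows "is_monomial_about c d (\<lambda>z. of_real (mono2 c i j z))"
  unfolding is_monomial_about_def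
  by (rule exI[of _ "\<chi> k. if k = 1 then i else j"]) (use assms in \<open>simp add: UNIV_2\<close>)

text \<open>Comparison with the 1-norm: each of the two coordinates contributes at most
  \<open>w / 2\<close>. With this constant the product of the displacements is bounded by w_A w_B
  directly.\<close>

lemma norm_diff_le_square_width:
  assumes "x \<in> square c w"
  shows "norm (x - c) \<le> w"
proof -
  have "norm (x - c) \<le> (\<Sum>i\<in>UNIV. \<bar>(x - c) $ i\<bar>)" by (rule norm_le_l1_cart)
  also have "\<dots> \<le> (\<Sum>i\<in>(UNIV :: 2 set). w / 2)"
  proof (rule sum_mono)
    fix i :: 2
    have "c $ i - w / 2 \<le> x $ i" "x $ i \<le> c $ i + w / 2"
      using assms by (simp_all add: square_def mem_box_cart)
    then show "\<bar>(x - c) $ i\<bar> \<le> w / 2"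
      unfolding vector_minus_component abs_le_iff by linarith
  qed
  finally show ?thesis by simp
qed

lemma center_in_square: "w \<ge> 0 \<Longrightarrow> c \<in> square c w"
  by (simp add: square_def mem_box_cart)

lemma norm_le_2_spatial_domain:
  assumes "x \<in> spatial_domain" "y \<in> spatial_domain"
  shows "norm (x - y) \<le> 2"
proof -
  have "norm (x - y) \<le> (\<Sum>i\<in>UNIV. \<bar>(x - y) $ i\<bar>)" by (rule norm_le_l1_cart)
  also have "\<dots> \<le> (\<Sum>i\<in>(UNIV :: 2 set). 1)"
  proof (rule sum_mono)
    fix i :: 2
    have "0 \<le> x $ i" "x $ i \<le> 1" "0 \<le> y $ i" "y $ i \<le> 1"
      using assms by (simp_all add: mem_box_cart)
    then show "\<bar>(x - y) $ i\<bar> \<le> 1" by (simp add: abs_le_iff)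
  qed
  finally show ?thesis by simp
qed

lemma norm_le_frequency_domain:
  assumes "\<xi> \<in> frequency_domain N"
  shows "norm \<xi> \<le> real N"
proof -
  have "norm \<xi> \<le> (\<Sum>i\<in>UNIV. \<bar>\<xi> $ i\<bar>)" by (rule norm_le_l1_cart)
  also have "\<dots> \<le> (\<Sum>i\<in>(UNIV :: 2 set). real N / 2)"
  proof (rule sum_mono)
    fix i :: 2
    have "- real N / 2 \<le> \<xi> $ i" "\<xi> $ i \<le> real N / 2"
      using assms by (simp_all add: mem_box_cart)
    then show "\<bar>\<xi> $ i\<bar> \<le> real N / 2" by (simp add: abs_le_iff)
  qed
  finally show ?thesis by simp
qed

subsection \<open>The residue phase\<close>

lemma residue_phase_eq_mixdiff:
  assumes hom: "\<forall>x\<in>spatial_domain. \<forall>\<xi>. \<forall>s>0. \<Phi> x (s *\<^sub>R \<xi>) = s * \<Phi> x \<xi>"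
    and "x \<in> spatial_domain" "c\<^sub>A \<in> spatial_domain" "s > 0"
  shows "residue_phase \<Phi> c\<^sub>A c\<^sub>B x \<xi> = s * mixdiff \<Phi> x c\<^sub>A (inverse s *\<^sub>R \<xi>) (inverse s *\<^sub>R c\<^sub>B)"
proof -
  have "\<Phi> y \<eta> = s * \<Phi> y (inverse s *\<^sub>R \<eta>)" if "y \<in> spatial_domain" for y \<eta>
    using hom[rule_format, OF that \<open>s > 0\<close>, of "inverse s *\<^sub>R \<eta>"] \<open>s > 0\<close> by simp
  from this[OF assms(2), of \<xi>] this[OF assms(2), of c\<^sub>B] this[OF assms(3), of \<xi>] this[OF assms(3), of c\<^sub>B]
  show ?thesis by (simp add: residue_phase_def mixdiff_def algebra_simps)
qed

text \<open>After division by N the frequency displacement is below \<open>\<delta>\<close>, while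
  the spatial one, at most 2, is subdivided into \<open>n\<close> pieces.\<close>

lemma residue_phase_approx_frequency:
  fixes N :: nat
  assumes approx: "uniformly_approximable \<Phi> spatial_domain {\<xi>. 1/4 \<le> norm \<xi> \<and> norm \<xi> \<le> 1} \<delta> C"
    and \<delta>: "\<delta> > 0" and C: "C \<ge> 0" and n: "real n * \<delta> > 2"
    and hom: "\<forall>x\<in>spatial_domain. \<forall>\<xi>. \<forall>s>0. \<Phi> x (s *\<^sub>R \<xi>) = s * \<Phi> x \<xi>"
    and N: "N > 0" "w\<^sub>B < real N * \<delta>" and w: "w\<^sub>A * w\<^sub>B \<le> 1" "w\<^sub>A > 0" "w\<^sub>B > 0"
    and A: "square c\<^sub>A w\<^sub>A \<subseteq> spatial_domain"
    and B: "\<And>\<xi>. \<xi> \<in> square c\<^sub>B w\<^sub>B \<Longrightarrow> real N / 4 \<le> norm \<xi> \<and> norm \<xi> \<le> real N"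
    and x: "x \<in> square c\<^sub>A w\<^sub>A"
  shows "\<exists>Q. poly2 m Q \<and> (\<forall>\<xi>\<in>square c\<^sub>B w\<^sub>B. \<bar>residue_phase \<Phi> c\<^sub>A c\<^sub>B x \<xi> - Q \<xi>\<bar> \<le> C / 2 ^ m)"
    and "\<And>\<xi>. \<xi> \<in> square c\<^sub>B w\<^sub>B \<Longrightarrow> \<bar>residue_phase \<Phi> c\<^sub>A c\<^sub>B x \<xi>\<bar> \<le> C"
proof -
  let ?K = "{\<xi> :: real ^ 2. 1/4 \<le> norm \<xi> \<and> norm \<xi> \<le> 1}"
  let ?s = "\<lambda>\<xi>. inverse (real N) *\<^sub>R \<xi> :: real ^ 2"
  have cA: "c\<^sub>A \<in> square c\<^sub>A w\<^sub>A" and cB: "c\<^sub>B \<in> square c\<^sub>B w\<^sub>B" using w by (simp_all add: center_in_square)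
  have xA: "x \<in> spatial_domain" "c\<^sub>A \<in> spatial_domain" using A x cA by auto
  have seg: "closed_segment c\<^sub>A x \<subseteq> spatial_domain" using xA by (intro closed_segment_subset) auto
  have len: "norm (x - c\<^sub>A) < real n * \<delta>" using norm_le_2_spatial_domain[OF xA] n by linarith
  have K: "?s \<xi> \<in> ?K" if "\<xi> \<in> square c\<^sub>B w\<^sub>B" for \<xi>
    using B[OF that] N(1) by (simp add: field_simps)
  \<comment> \<open>The scaled frequency displacement carries a factor 1/N, which cancels the N from
    homogeneity and leaves w_A w_B, at most 1.\<close>
  have near: "?s \<xi> \<in> ?K \<inter> ball (?s c\<^sub>B) \<delta>" and prod: "real N * (norm (x - c\<^sub>A) * norm (?s \<xi> - ?s c\<^sub>B)) \<le> 1"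
    if \<xi>: "\<xi> \<in> square c\<^sub>B w\<^sub>B" for \<xi>
  proof -
    have d: "norm (?s \<xi> - ?s c\<^sub>B) = norm (\<xi> - c\<^sub>B) / N"
      using N(1) by (simp add: scaleR_diff_right[symmetric] divide_inverse)
    have "norm (\<xi> - c\<^sub>B) / N < \<delta>"
      using norm_diff_le_square_width[OF \<xi>] N by (simp add: divide_less_eq mult.commute)
    then show "?s \<xi> \<in> ?K \<inter> ball (?s c\<^sub>B) \<delta>"
      using K[OF \<xi>] d by (simp add: dist_norm norm_minus_commute)
    have "norm (x - c\<^sub>A) * norm (\<xi> - c\<^sub>B) \<le> w\<^sub>A * w\<^sub>B"
      using norm_diff_le_square_width[OF x] norm_diff_le_square_width[OF \<xi>] w by (intro mult_mono) auto
    then show "real N * (norm (x - c\<^sub>A) * norm (?s \<xi> - ?s c\<^sub>B)) \<le> 1"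
      using N(1) w(1) unfolding d by simp
  qed
  have R: "residue_phase \<Phi> c\<^sub>A c\<^sub>B x \<xi> = real N * mixdiff \<Phi> x c\<^sub>A (?s \<xi>) (?s c\<^sub>B)" for \<xi>
    using residue_phase_eq_mixdiff[OF hom xA] N(1) by simp
  have scaled: "real N * (e * norm (x - c\<^sub>A) * norm (?s \<xi> - ?s c\<^sub>B)) \<le> e"
    if "\<xi> \<in> square c\<^sub>B w\<^sub>B" "e \<ge> 0" for e \<xi>
    using mult_left_mono[OF prod[OF that(1)] that(2)] by (simp add: mult_ac)
  obtain Q where Q: "poly2 m Q" and err: "\<forall>\<xi>\<in>?K \<inter> ball (?s c\<^sub>B) \<delta>. \<bar>mixdiff \<Phi> x c\<^sub>A \<xi> (?s c\<^sub>B) - Q \<xi>\<bar>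
      \<le> C / 2 ^ m * norm (x - c\<^sub>A) * norm (\<xi> - ?s c\<^sub>B)"
    using mixdiff_segment_approx[OF approx \<delta> seg len K[OF cB], of m] by blast
  show "\<exists>Q. poly2 m Q \<and> (\<forall>\<xi>\<in>square c\<^sub>B w\<^sub>B. \<bar>residue_phase \<Phi> c\<^sub>A c\<^sub>B x \<xi> - Q \<xi>\<bar> \<le> C / 2 ^ m)"
  proof (rule exI[of _ "\<lambda>\<xi>. real N * Q (?s \<xi>)"], intro conjI ballI)
    show "poly2 m (\<lambda>\<xi>. real N * Q (?s \<xi>))"
      by (rule poly2_cmult, rule poly2_scale, rule Q)
    fix \<xi> assume \<xi>: "\<xi> \<in> square c\<^sub>B w\<^sub>B"
    have "\<bar>residue_phase \<Phi> c\<^sub>A c\<^sub>B x \<xi> - real N * Q (?s \<xi>)\<bar> = real N * \<bar>mixdiff \<Phi> x c\<^sub>A (?s \<xi>) (?s c\<^sub>B) - Q (?s \<xi>)\<bar>"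
      unfolding R right_diff_distrib[symmetric] abs_mult by simp
    also have "\<dots> \<le> real N * (C / 2 ^ m * norm (x - c\<^sub>A) * norm (?s \<xi> - ?s c\<^sub>B))"
      by (rule mult_left_mono[OF err[rule_format, OF near[OF \<xi>]]]) simp
    also have "\<dots> \<le> C / 2 ^ m"
      using C by (intro scaled[OF \<xi>]) simp
    finally show "\<bar>residue_phase \<Phi> c\<^sub>A c\<^sub>B x \<xi> - real N * Q (?s \<xi>)\<bar> \<le> C / 2 ^ m" .
  qed
  show "\<bar>residue_phase \<Phi> c\<^sub>A c\<^sub>B x \<xi>\<bar> \<le> C" if \<xi>: "\<xi> \<in> square c\<^sub>B w\<^sub>B" for \<xi>
  proof -
    have "\<bar>residue_phase \<Phi> c\<^sub>A c\<^sub>B x \<xi>\<bar> = real N * \<bar>mixdiff \<Phi> x c\<^sub>A (?s \<xi>) (?s c\<^sub>B)\<bar>"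
      unfolding R abs_mult by simp
    also have "\<dots> \<le> real N * (C * norm (x - c\<^sub>A) * norm (?s \<xi> - ?s c\<^sub>B))"
      by (rule mult_left_mono[OF mixdiff_segment_bound[OF approx \<delta> seg len K[OF cB] near[OF \<xi>]]]) simp
    also have "\<dots> \<le> C"
      by (rule scaled[OF \<xi> C])
    finally show ?thesis .
  qed
qed

text \<open>The mirror image under exchange of the variables: now the spatial displacement is short
  and the scaled frequency displacement is subdivided.\<close>

lemma residue_phase_approx_space:
  fixes N :: nat
  assumes approx: "uniformly_approximable \<Phi> spatial_domain {\<xi>. 1/4 \<le> norm \<xi> \<and> norm \<xi> \<le> 1} \<delta> C"
    and \<delta>: "\<delta> > 0" and C: "C \<ge> 0" and n: "real n * \<delta> > 2"
    and hom: "\<forall>x\<in>spatial_domain. \<forall>\<xi>. \<forall>s>0. \<Phi> x (s *\<^sub>R \<xi>) = s * \<Phi> x \<xi>"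
    and N: "N > 0" "w\<^sub>A < \<delta>" and w: "w\<^sub>A * w\<^sub>B \<le> 1" "w\<^sub>A > 0" "w\<^sub>B > 0"
    and A: "square c\<^sub>A w\<^sub>A \<subseteq> spatial_domain"
    and B: "\<And>\<xi>. \<xi> \<in> square c\<^sub>B w\<^sub>B \<Longrightarrow> real N / 4 \<le> norm \<xi> \<and> norm \<xi> \<le> real N"
    and \<xi>: "\<xi> \<in> square c\<^sub>B w\<^sub>B"
  shows "\<exists>Q. poly2 m Q \<and> (\<forall>x\<in>square c\<^sub>A w\<^sub>A. \<bar>residue_phase \<Phi> c\<^sub>A c\<^sub>B x \<xi> - Q x\<bar> \<le> C / 2 ^ m)"
    and "\<And>x. x \<in> square c\<^sub>A w\<^sub>A \<Longrightarrow> \<bar>residue_phase \<Phi> c\<^sub>A c\<^sub>B x \<xi>\<bar> \<le> C"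
proof -
  let ?K = "{\<xi> :: real ^ 2. 1/4 \<le> norm \<xi> \<and> norm \<xi> \<le> 1}"
  let ?s = "\<lambda>\<xi>. inverse (real N) *\<^sub>R \<xi> :: real ^ 2"
  let ?\<Psi> = "\<lambda>\<xi> x. \<Phi> x \<xi>"
  note approx' = uniformly_approximable_swap[OF approx]
  have cA: "c\<^sub>A \<in> square c\<^sub>A w\<^sub>A" and cB: "c\<^sub>B \<in> square c\<^sub>B w\<^sub>B" using w by (simp_all add: center_in_square)
  have cA': "c\<^sub>A \<in> spatial_domain" using A cA by auto
  have K: "?s \<eta> \<in> ?K" if "\<eta> \<in> square c\<^sub>B w\<^sub>B" for \<eta>
    using B[OF that] N(1) by (simp add: field_simps)
  \<comment> \<open>The annulus \<open>?K\<close> is not convex, so the segment is kept inside it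
    through the scaled square, which is convex and contained in \<open>?K\<close>.\<close>
  have "convex (?s ` square c\<^sub>B w\<^sub>B)"
    unfolding square_def by (intro convex_scaling convex_box)
  then have "closed_segment (?s c\<^sub>B) (?s \<xi>) \<subseteq> ?s ` square c\<^sub>B w\<^sub>B"
    using cB \<xi> by (intro closed_segment_subset) auto
  then have seg: "closed_segment (?s c\<^sub>B) (?s \<xi>) \<subseteq> ?K"
    using K by blast
  have d: "norm (?s \<xi> - ?s c\<^sub>B) = norm (\<xi> - c\<^sub>B) / N"
    using N(1) by (simp add: scaleR_diff_right[symmetric] divide_inverse)
  \<comment> \<open>Both scaled frequencies have norm at most 1, so their distance is at most
    2.\<close>
  have "norm (?s \<xi> - ?s c\<^sub>B) \<le> norm (?s \<xi>) + norm (?s c\<^sub>B)"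
    by (rule norm_triangle_ineq4)
  then have len: "norm (?s \<xi> - ?s c\<^sub>B) < real n * \<delta>"
    using K[OF \<xi>] K[OF cB] n by simp
  have near: "x \<in> spatial_domain \<inter> ball c\<^sub>A \<delta>" and prod: "real N * (norm (?s \<xi> - ?s c\<^sub>B) * norm (x - c\<^sub>A)) \<le> 1"
    if x: "x \<in> square c\<^sub>A w\<^sub>A" for x
  proof -
    have "dist c\<^sub>A x < \<delta>"
      using norm_diff_le_square_width[OF x] N(2) by (simp add: dist_norm norm_minus_commute)
    then show "x \<in> spatial_domain \<inter> ball c\<^sub>A \<delta>" using A x by auto
    have "norm (\<xi> - c\<^sub>B) * norm (x - c\<^sub>A) \<le> w\<^sub>B * w\<^sub>A"
      using norm_diff_le_square_width[OF x] norm_diff_le_square_width[OF \<xi>] w by (intro mult_mono) auto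
    then show "real N * (norm (?s \<xi> - ?s c\<^sub>B) * norm (x - c\<^sub>A)) \<le> 1"
      using N(1) w(1) unfolding d by (simp add: mult.commute)
  qed
  have R: "residue_phase \<Phi> c\<^sub>A c\<^sub>B x \<xi> = real N * mixdiff ?\<Psi> (?s \<xi>) (?s c\<^sub>B) x c\<^sub>A" if "x \<in> square c\<^sub>A w\<^sub>A" for x
  proof -
    have "mixdiff \<Phi> x c\<^sub>A (?s \<xi>) (?s c\<^sub>B) = mixdiff ?\<Psi> (?s \<xi>) (?s c\<^sub>B) x c\<^sub>A"
      by (simp add: mixdiff_def)
    moreover have "x \<in> spatial_domain" using A that by auto
    ultimately show ?thesis
      using residue_phase_eq_mixdiff[OF hom _ cA', of x "real N"] N(1) by simp
  qed
  have scaled: "real N * (e * norm (?s \<xi> - ?s c\<^sub>B) * norm (x - c\<^sub>A)) \<le> e"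
    if "x \<in> square c\<^sub>A w\<^sub>A" "e \<ge> 0" for e x
    using mult_left_mono[OF prod[OF that(1)] that(2)] by (simp add: mult_ac)
  obtain Q where Q: "poly2 m Q" and err: "\<forall>x\<in>spatial_domain \<inter> ball c\<^sub>A \<delta>. \<bar>mixdiff ?\<Psi> (?s \<xi>) (?s c\<^sub>B) x c\<^sub>A - Q x\<bar>
      \<le> C / 2 ^ m * norm (?s \<xi> - ?s c\<^sub>B) * norm (x - c\<^sub>A)"
    using mixdiff_segment_approx[OF approx' \<delta> seg len cA', of m] by blast
  show "\<exists>Q. poly2 m Q \<and> (\<forall>x\<in>square c\<^sub>A w\<^sub>A. \<bar>residue_phase \<Phi> c\<^sub>A c\<^sub>B x \<xi> - Q x\<bar> \<le> C / 2 ^ m)"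
  proof (rule exI[of _ "\<lambda>x. real N * Q x"], intro conjI ballI)
    show "poly2 m (\<lambda>x. real N * Q x)"
      by (rule poly2_cmult, rule Q)
    fix x assume x: "x \<in> square c\<^sub>A w\<^sub>A"
    have "\<bar>residue_phase \<Phi> c\<^sub>A c\<^sub>B x \<xi> - real N * Q x\<bar> = real N * \<bar>mixdiff ?\<Psi> (?s \<xi>) (?s c\<^sub>B) x c\<^sub>A - Q x\<bar>"
      unfolding R[OF x] right_diff_distrib[symmetric] abs_mult by simp
    also have "\<dots> \<le> real N * (C / 2 ^ m * norm (?s \<xi> - ?s c\<^sub>B) * norm (x - c\<^sub>A))"
      by (rule mult_left_mono[OF err[rule_format, OF near[OF x]]]) simp
    also have "\<dots> \<le> C / 2 ^ m"
      using C by (intro scaled[OF x]) simp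
    finally show "\<bar>residue_phase \<Phi> c\<^sub>A c\<^sub>B x \<xi> - real N * Q x\<bar> \<le> C / 2 ^ m" .
  qed
  show "\<bar>residue_phase \<Phi> c\<^sub>A c\<^sub>B x \<xi>\<bar> \<le> C" if x: "x \<in> square c\<^sub>A w\<^sub>A" for x
  proof -
    have "\<bar>residue_phase \<Phi> c\<^sub>A c\<^sub>B x \<xi>\<bar> = real N * \<bar>mixdiff ?\<Psi> (?s \<xi>) (?s c\<^sub>B) x c\<^sub>A\<bar>"
      unfolding R[OF x] abs_mult by simp
    also have "\<dots> \<le> real N * (C * norm (?s \<xi> - ?s c\<^sub>B) * norm (x - c\<^sub>A))"
      by (rule mult_left_mono[OF mixdiff_segment_bound[OF approx' \<delta> seg len cA' near[OF x]]]) simp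
    also have "\<dots> \<le> C"
      by (rule scaled[OF x C])
    finally show ?thesis .
  qed
qed

section \<open>Choice of the truncation order and the final assembly\<close>

text \<open>The order is log_2 (M / \<epsilon>) rounded up. Because \<epsilon> is at most 1/e, ln (1
  / \<epsilon>) is at least 1, so the additive constants log_2 M and 1 are absorbed by multiplying
  them with it.\<close>

lemma truncation_order:
  fixes M \<epsilon> :: real
  assumes M: "M \<ge> 1" and \<epsilon>: "0 < \<epsilon>" "\<epsilon> \<le> exp (- 1)"
  obtains m :: nat where "M / 2 ^ m \<le> \<epsilon>" "real m \<le> (log 2 M + 1 / ln 2 + 1) * ln (1 / \<epsilon>)"
proof
  define m where "m = nat \<lceil>log 2 (M / \<epsilon>)\<rceil>"
  have "ln \<epsilon> \<le> - 1" using \<epsilon> by (metis ln_exp ln_le_cancel_iff exp_gt_zero)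
  then have l: "ln (1 / \<epsilon>) \<ge> 1" using \<epsilon> by (simp add: ln_div)
  have "M / \<epsilon> \<ge> 1" using M \<epsilon> by (simp add: le_divide_eq) (use \<open>ln \<epsilon> \<le> - 1\<close> in \<open>smt (verit) exp_le_one_iff one_le_exp_iff\<close>)
  then have pos: "log 2 (M / \<epsilon>) \<ge> 0" by simp
  have "M / \<epsilon> = 2 powr log 2 (M / \<epsilon>)"
    using M \<epsilon> by simp
  also have "\<dots> \<le> 2 powr real m"
    unfolding m_def using real_nat_ceiling_ge[of "log 2 (M / \<epsilon>)"] by (intro powr_mono) auto
  also have "\<dots> = 2 ^ m" by (simp add: powr_realpow)
  finally show "M / 2 ^ m \<le> \<epsilon>" using \<epsilon> by (simp add: field_simps)
  have "real m \<le> log 2 (M / \<epsilon>) + 1"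
    unfolding m_def using pos by linarith
  also have "log 2 (M / \<epsilon>) = log 2 M + ln (1 / \<epsilon>) / ln 2"
    using M \<epsilon> by (simp add: log_def ln_div diff_divide_distrib)
  also have "log 2 M + ln (1 / \<epsilon>) / ln 2 + 1 \<le> log 2 M * ln (1 / \<epsilon>) + ln (1 / \<epsilon>) / ln 2 + ln (1 / \<epsilon>)"
    using l M mult_left_mono[OF l, of "log 2 M"] by simp
  also have "\<dots> = (log 2 M + 1 / ln 2 + 1) * ln (1 / \<epsilon>)"
    by (simp add: algebra_simps)
  finally show "real m \<le> (log 2 M + 1 / ln 2 + 1) * ln (1 / \<epsilon>)" .
qed

theorem theorem3p1:
  fixes \<Phi> :: "real ^ 2 \<Rightarrow> real ^ 2 \<Rightarrow> real"
  assumes "phase_function \<Phi>"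
    and "real_analytic_on (spatial_domain \<times> (UNIV - {0})) (\<lambda>(x, \<xi>). \<Phi> x \<xi>)"
  shows "\<exists>\<epsilon>\<^sub>0 N\<^sub>0 C C\<^sub>\<beta> C\<^sub>\<alpha> :: real.
    \<epsilon>\<^sub>0 > 0 \<and> N\<^sub>0 > 0 \<and> C > 0 \<and> C\<^sub>\<beta> > 0 \<and> C\<^sub>\<alpha> > 0 \<and>
    (\<forall>(N :: nat) (c\<^sub>A :: real ^ 2) (w\<^sub>A :: real) (c\<^sub>B :: real ^ 2) (w\<^sub>B :: real) (\<epsilon> :: real).
       N > 0 \<and> real N \<ge> N\<^sub>0 \<and> w\<^sub>A > 0 \<and> w\<^sub>B > 0 \<and>
       square c\<^sub>A w\<^sub>A \<subseteq> spatial_domain \<and> square c\<^sub>B w\<^sub>B \<subseteq> frequency_domain N \<and>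
       w\<^sub>A * w\<^sub>B \<le> 1 \<and> infdist 0 (square c\<^sub>B w\<^sub>B) \<ge> real N / 4 \<and>
       0 < \<epsilon> \<and> \<epsilon> \<le> \<epsilon>\<^sub>0 \<longrightarrow>
       (\<exists>r :: nat. real r \<le> C * ln (1 / \<epsilon>) ^ 4 \<and>
          (\<exists>\<alpha> \<beta>. separated_approx \<Phi> c\<^sub>A w\<^sub>A c\<^sub>B w\<^sub>B \<epsilon> r \<alpha> \<beta>) \<and>
          (w\<^sub>B \<le> sqrt (real N) \<longrightarrow>
             (\<exists>\<alpha> \<beta>. separated_approx \<Phi> c\<^sub>A w\<^sub>A c\<^sub>B w\<^sub>B \<epsilon> r \<alpha> \<beta> \<and>
                (\<forall>t\<in>{1..r}. is_monomial_about c\<^sub>B (C\<^sub>\<beta> * ln (1 / \<epsilon>) ^ 2) (\<beta> t)))) \<and>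
          (w\<^sub>A \<le> 1 / sqrt (real N) \<longrightarrow>
             (\<exists>\<alpha> \<beta>. separated_approx \<Phi> c\<^sub>A w\<^sub>A c\<^sub>B w\<^sub>B \<epsilon> r \<alpha> \<beta> \<and>
                (\<forall>t\<in>{1..r}. is_monomial_about c\<^sub>A (C\<^sub>\<alpha> * ln (1 / \<epsilon>) ^ 2) (\<alpha> t))))))"
proof -
  \<comment> \<open>Frequencies with norm between N/4 and N land here after division by N; this
    annulus is compact and avoids the singularity at 0.\<close>
  let ?K = "{\<xi> :: real ^ 2. 1/4 \<le> norm \<xi> \<and> norm \<xi> \<le> 1}"
  have hom: "\<forall>x\<in>spatial_domain. \<forall>\<xi>. \<forall>s>0. \<Phi> x (s *\<^sub>R \<xi>) = s * \<Phi> x \<xi>"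
    using assms(1) by (simp add: phase_function_def)
  have "?K = cball 0 1 - ball 0 (1/4)" by auto
  then have K: "compact ?K" by (simp add: compact_diff)
  have "spatial_domain \<times> ?K \<subseteq> spatial_domain \<times> (UNIV - {0})" by auto
  then obtain \<delta> C where \<delta>: "\<delta> > 0" and C: "C \<ge> 0"
    and approx: "uniformly_approximable \<Phi> spatial_domain ?K \<delta> C"
    using real_analytic_on_uniformly_approximable[OF assms(2) compact_cbox K] by blast
  obtain n :: nat where n: "real n * \<delta> > 2"
    using reals_Archimedean3[OF \<delta>] by blast
  \<comment> \<open>The final 1 ensures that \<open>M\<close> is at least 1, as the choice of the
    order requires.\<close>
  define M where "M = 2 * pi * C + 4 * pi * C * exp (8 * pi * C) + 1"
  have M: "M \<ge> 2 * pi * C + 4 * pi * C * exp (8 * pi * C)" "M \<ge> 1"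
    using C by (simp_all add: M_def)
  define H where "H = log 2 M + 1 / ln 2 + 1"
  have H: "H \<ge> 1" using M by (simp add: H_def)
  \<comment> \<open>This forces sqrt N > 1/\<delta>, hence both sqrt N < N \<delta> and 1 / sqrt N <
    \<delta>: in either case of the theorem the displacement to be expanded is short enough.\<close>
  define N\<^sub>0 where "N\<^sub>0 = (1 / \<delta>)\<^sup>2 + 1"
  have N\<^sub>0: "N\<^sub>0 > 0" by (simp add: N\<^sub>0_def add_nonneg_pos)
  \<comment> \<open>With l = ln (1 / \<epsilon>), at least 1, and d = m^2 \<le> H^2 l^2, the number
    of terms (d + 1)^2 is at most (H^2 + 1)^2 l^4, and a monomial of degree at most d in each
    variable has total degree at most 2 d.\<close>
  show ?thesis
  proof (rule exI[of _ "exp (- 1)"], rule exI[of _ N\<^sub>0], rule exI[of _ "(H\<^sup>2 + 1)\<^sup>2"],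
      rule exI[of _ "2 * H\<^sup>2"], rule exI[of _ "2 * H\<^sup>2"], intro conjI allI impI)
    show "(H\<^sup>2 + 1)\<^sup>2 > 0" by (intro zero_less_power add_nonneg_pos) auto
    show "exp (- 1) > (0 :: real)" "N\<^sub>0 > 0" "2 * H\<^sup>2 > 0" "2 * H\<^sup>2 > 0"
      using N\<^sub>0 H by simp_all
  next
    fix N :: nat and c\<^sub>A :: "real ^ 2" and w\<^sub>A :: real and c\<^sub>B :: "real ^ 2" and w\<^sub>B \<epsilon> :: real
    assume asm: "N > 0 \<and> real N \<ge> N\<^sub>0 \<and> w\<^sub>A > 0 \<and> w\<^sub>B > 0 \<and>
       square c\<^sub>A w\<^sub>A \<subseteq> spatial_domain \<and> square c\<^sub>B w\<^sub>B \<subseteq> frequency_domain N \<and>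
       w\<^sub>A * w\<^sub>B \<le> 1 \<and> infdist 0 (square c\<^sub>B w\<^sub>B) \<ge> real N / 4 \<and>
       0 < \<epsilon> \<and> \<epsilon> \<le> exp (- 1)"
    then have N: "N > 0" "real N \<ge> N\<^sub>0" and w: "w\<^sub>A > 0" "w\<^sub>B > 0" "w\<^sub>A * w\<^sub>B \<le> 1"
      and A: "square c\<^sub>A w\<^sub>A \<subseteq> spatial_domain" and \<epsilon>: "0 < \<epsilon>" "\<epsilon> \<le> exp (- 1)" by auto
    have B: "real N / 4 \<le> norm \<xi> \<and> norm \<xi> \<le> real N" if "\<xi> \<in> square c\<^sub>B w\<^sub>B" for \<xi>
      using asm infdist_le[OF that, of 0] norm_le_frequency_domain[of \<xi> N] that by auto
    have "(1 / \<delta>)\<^sup>2 < real N" using N by (simp add: N\<^sub>0_def)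
    then have "1 / \<delta> < sqrt (real N)" by (rule real_less_rsqrt)
    then have s\<delta>: "1 < sqrt (real N) * \<delta>" using \<delta> by (simp add: divide_less_eq)
    have s0: "sqrt (real N) > 0" using N(1) by simp
    define l where "l = ln (1 / \<epsilon>)"
    have "ln \<epsilon> \<le> ln (exp (- 1))" using \<epsilon> by (subst ln_le_cancel_iff) auto
    then have l: "l \<ge> 1" using \<epsilon> by (simp add: l_def ln_div)
    obtain m :: nat where m: "M / 2 ^ m \<le> \<epsilon>" "real m \<le> H * l"
      using truncation_order[OF M(2) \<epsilon>] unfolding H_def l_def by blast
    define d where "d = m * m"
    have "real m * real m \<le> (H * l) * (H * l)"
      using m(2) H l by (intro mult_mono) auto
    then have d: "real d \<le> H\<^sup>2 * l\<^sup>2"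
      by (simp add: d_def power2_eq_square mult_ac)
    let ?r = "(Suc d)\<^sup>2"
    have "1 \<le> l\<^sup>2" using l by simp
    then have "real (Suc d) \<le> (H\<^sup>2 + 1) * l\<^sup>2"
      using d by (simp add: algebra_simps)
    then have "(real (Suc d))\<^sup>2 \<le> ((H\<^sup>2 + 1) * l\<^sup>2)\<^sup>2"
      by (intro power_mono) auto
    also have "\<dots> = (H\<^sup>2 + 1)\<^sup>2 * l ^ 4"
      by (simp add: power_mult_distrib)
    finally have r: "real ?r \<le> (H\<^sup>2 + 1)\<^sup>2 * ln (1 / \<epsilon>) ^ 4"
      by (simp add: l_def)
    have deg: "real ((t - 1) div Suc d + (t - 1) mod Suc d) \<le> 2 * H\<^sup>2 * ln (1 / \<epsilon>) ^ 2" if "t \<in> {1..?r}" for t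
    proof -
      have "t - 1 < Suc d * Suc d"
        using that unfolding power2_eq_square atLeastAtMost_iff by linarith
      then have "(t - 1) div Suc d < Suc d"
        by (rule less_mult_imp_div_less)
      moreover have "(t - 1) mod Suc d < Suc d"
        by (rule mod_less_divisor) simp
      ultimately have "real ((t - 1) div Suc d + (t - 1) mod Suc d) \<le> 2 * real d"
        by linarith
      then show ?thesis using d by (simp add: l_def)
    qed
    let ?mono = "\<lambda>c t z. complex_of_real (mono2 c ((t - 1) div Suc d) ((t - 1) mod Suc d) z)"
    have mono: "is_monomial_about c (2 * H\<^sup>2 * ln (1 / \<epsilon>) ^ 2) (?mono c t)" if "t \<in> {1..?r}" for c t
      by (rule is_monomial_about_mono2[OF deg[OF that]])
    have i: "\<exists>\<alpha> \<beta>. separated_approx \<Phi> c\<^sub>A w\<^sub>A c\<^sub>B w\<^sub>B \<epsilon> ?r \<alpha> \<beta> \<and>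
                (\<forall>t\<in>{1..?r}. is_monomial_about c\<^sub>B (2 * H\<^sup>2 * ln (1 / \<epsilon>) ^ 2) (\<beta> t))"
      if "w\<^sub>B \<le> sqrt (real N)"
    proof -
      have "sqrt (real N) * 1 < sqrt (real N) * (sqrt (real N) * \<delta>)"
        using s\<delta> s0 by (rule mult_strict_left_mono)
      then have "w\<^sub>B < real N * \<delta>" using that by (simp add: mult.assoc[symmetric])
      note R = residue_phase_approx_frequency[OF approx \<delta> C n hom N(1) this w(3,1,2) A B]
      obtain \<gamma> where \<gamma>: "\<forall>x\<in>square c\<^sub>A w\<^sub>A. \<forall>\<xi>\<in>square c\<^sub>B w\<^sub>B.
          cmod (exp (2 * of_real pi * \<i> * of_real (residue_phase \<Phi> c\<^sub>A c\<^sub>B x \<xi>)) - (\<Sum>t=1..?r. \<gamma> t x * ?mono c\<^sub>B t \<xi>)) \<le> M / 2 ^ m"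
        using exp_phase_monomial_approx[where A = "square c\<^sub>A w\<^sub>A" and B = "square c\<^sub>B w\<^sub>B"
            and G = "residue_phase \<Phi> c\<^sub>A c\<^sub>B" and m = m and C = C and c = c\<^sub>B, OF R M(1) C]
        unfolding d_def by blast
      have "separated_approx \<Phi> c\<^sub>A w\<^sub>A c\<^sub>B w\<^sub>B \<epsilon> ?r \<gamma> (?mono c\<^sub>B)"
        unfolding separated_approx_def
        by (intro ballI order_trans[OF \<gamma>[rule_format] m(1)])
      then show ?thesis using mono by blast
    qed
    have ii: "\<exists>\<alpha> \<beta>. separated_approx \<Phi> c\<^sub>A w\<^sub>A c\<^sub>B w\<^sub>B \<epsilon> ?r \<alpha> \<beta> \<and>
                (\<forall>t\<in>{1..?r}. is_monomial_about c\<^sub>A (2 * H\<^sup>2 * ln (1 / \<epsilon>) ^ 2) (\<alpha> t))"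
      if "w\<^sub>A \<le> 1 / sqrt (real N)"
    proof -
      have "1 / sqrt (real N) < \<delta>" using s\<delta> s0 by (simp add: divide_less_eq mult.commute)
      then have "w\<^sub>A < \<delta>" using that by linarith
      note R = residue_phase_approx_space[OF approx \<delta> C n hom N(1) this w(3,1,2) A B]
      obtain \<gamma> where \<gamma>: "\<forall>\<xi>\<in>square c\<^sub>B w\<^sub>B. \<forall>x\<in>square c\<^sub>A w\<^sub>A.
          cmod (exp (2 * of_real pi * \<i> * of_real (residue_phase \<Phi> c\<^sub>A c\<^sub>B x \<xi>)) - (\<Sum>t=1..?r. \<gamma> t \<xi> * ?mono c\<^sub>A t x)) \<le> M / 2 ^ m"
        using exp_phase_monomial_approx[where A = "square c\<^sub>B w\<^sub>B" and B = "square c\<^sub>A w\<^sub>A"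
            and G = "\<lambda>\<xi> x. residue_phase \<Phi> c\<^sub>A c\<^sub>B x \<xi>" and m = m and C = C and c = c\<^sub>A, OF R M(1) C]
        unfolding d_def by blast
      \<comment> \<open>Here the frequency is the parameter: the coefficients
        \<open>\<gamma>\<close> become the functions of \<xi>, and the monomials the functions of
        x.\<close>
      have "separated_approx \<Phi> c\<^sub>A w\<^sub>A c\<^sub>B w\<^sub>B \<epsilon> ?r (?mono c\<^sub>A) \<gamma>"
        unfolding separated_approx_def mult.commute[of "?mono c\<^sub>A _ _"]
        by (intro ballI order_trans[OF \<gamma>[rule_format] m(1)])
      then show ?thesis using mono by blast
    qed
    have "w\<^sub>B \<le> sqrt (real N) \<or> w\<^sub>A \<le> 1 / sqrt (real N)"
    proof (rule disjCI)
      assume "\<not> w\<^sub>A \<le> 1 / sqrt (real N)"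
      then have "1 \<le> w\<^sub>A * sqrt (real N)" using s0 by (simp add: divide_less_eq not_le)
      then have "w\<^sub>B * 1 \<le> w\<^sub>B * (w\<^sub>A * sqrt (real N))" using w(2) by (intro mult_left_mono) auto
      also have "\<dots> = (w\<^sub>A * w\<^sub>B) * sqrt (real N)" by simp
      also have "\<dots> \<le> 1 * sqrt (real N)" using w(3) by (intro mult_right_mono) auto
      finally show "w\<^sub>B \<le> sqrt (real N)" by simp
    qed
    \<comment> \<open>The unconditional claim is inherited from whichever case applies, so the same
      \<open>?r\<close> serves all three claims.\<close>
    then have "\<exists>\<alpha> \<beta>. separated_approx \<Phi> c\<^sub>A w\<^sub>A c\<^sub>B w\<^sub>B \<epsilon> ?r \<alpha> \<beta>"
      using i ii by blast
    with r i ii show "\<exists>r :: nat. real r \<le> (H\<^sup>2 + 1)\<^sup>2 * ln (1 / \<epsilon>) ^ 4 \<and>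
          (\<exists>\<alpha> \<beta>. separated_approx \<Phi> c\<^sub>A w\<^sub>A c\<^sub>B w\<^sub>B \<epsilon> r \<alpha> \<beta>) \<and>
          (w\<^sub>B \<le> sqrt (real N) \<longrightarrow>
             (\<exists>\<alpha> \<beta>. separated_approx \<Phi> c\<^sub>A w\<^sub>A c\<^sub>B w\<^sub>B \<epsilon> r \<alpha> \<beta> \<and>
                (\<forall>t\<in>{1..r}. is_monomial_about c\<^sub>B (2 * H\<^sup>2 * ln (1 / \<epsilon>) ^ 2) (\<beta> t)))) \<and>
          (w\<^sub>A \<le> 1 / sqrt (real N) \<longrightarrow>
             (\<exists>\<alpha> \<beta>. separated_approx \<Phi> c\<^sub>A w\<^sub>A c\<^sub>B w\<^sub>B \<epsilon> r \<alpha> \<beta> \<and>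
                (\<forall>t\<in>{1..r}. is_monomial_about c\<^sub>A (2 * H\<^sup>2 * ln (1 / \<epsilon>) ^ 2) (\<alpha> t))))"
      by (intro exI[of _ ?r] conjI impI)
  qed
qed

end
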